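(* Let $G$ be an abstract graph. Then $G$ is the Seifert graph of an oriented link diagram $D$ if and only if there exist a plane graph $H$ and a set $A\subseteq E(H)$ such that, with $H\cup H^*$ drawn on $S^2$ by the standard immersion and $$\Phi:=(H\cup H^* )-(A^c\cup A^* ),$$ each component of $\Phi$ is Eulerian and $$G\cong \Phi^{\circledast}.$$ Moreover, in this correspondence $H$ is (the underlying plane graph of) the bi-weighted Tait graph $\mathbb{T}_\sigma(D)$ and $A$ is the set of edges of $\mathbb{T}_\sigma(D)$ of weight $(+,+)$ or $(-,-)$. That is, for each oriented link diagram $D$ with Seifert graph $G$, these $H$ and $A$ satisfy that each component of $\Phi=(H\cup H^* )-(A^c\cup A^* )$ is Eulerian and $G\cong \Phi^{\circledast}$; and given any plane graph $H$ and any $A\subseteq E(H)$ such that each component of $\Phi=(H\cup H^* )-(A^c\cup A^* )$ is Eulerian and $G\cong \Phi^{\circledast}$, there is an oriented link diagram $D$ with Seifert graph $G$ such that $H$ is the underlying plane graph of $\mathbb{T}_\sigma(D)$ and $A$ is its set of edges of weight $(+,+)$ or $(-,-)$.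
   Context: Graphs may have loops and multiple edges. A graph is Eulerian if it is connected and every vertex has even degree (a loop counts twice; an isolated vertex is trivially Eulerian). $G\cong K$ means that $G$ and $K$ are isomorphic as abstract graphs (forgetting embeddings and edge weights). A link diagram $D\subset S^2$ is always assumed to be connected, i.e. each component of $S^2-D$ (a region of $D$) is a disc. A plane graph is a graph embedded in $S^2$ all of whose regions are discs (in particular it is connected). For a plane graph $H$, $H^*$ denotes its geometric dual and $e^*$ the edge of $H^*$ corresponding to $e\in E(H)$; for $A\subseteq E(H)$, $A^c=E(H)-A$ and $A^*=\{e^*: e\in A\}$. The standard immersion of $H\cup H^*$ draws $H$ and $H^*$ simultaneously on $S^2$, each vertex of one lying in the corresponding face of the other, such that each edge $e$ of $H$ meets exactly one edge of $H^*$, namely $e^*$, in exactly one point. The symbol "$-$" denotes deletion of edges. Thus $\Phi$ consists of the edges $e$ with $e\in A$ and the edges $e^*$ with $e\notin A$, and it is a graph embedded in $S^2$ (not necessarily cellularly). For a not necessarily cellularly embedded graph $\Phi\subset S^2$, the embedded graph $\Phi^{\circledast}$ has one vertex in each region (connected component of $S^2-\Phi$) of $\Phi$ and, for each edge of $\Phi$, one edge crossing it and joining the vertices in the regions on its two sides. The Seifert graph $\boldsymbol{S}(D)$ of an oriented link diagram $D$ is the abstract graph whose vertices are the Seifert circles (the circles obtained by smoothing every crossing consistently with the orientation) and which has one edge for each crossing, joining the Seifert circles that meet at that crossing. Tait graph: colour the regions of $D$ black and white so that adjacent regions have different colours (a checkerboard colouring). The Tait graph has one vertex in each black region and one edge through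 each crossing, joining the black regions that meet there. The $A$-splicing of a crossing is the smoothing joining the two local regions swept out when the over-strand is rotated counterclockwise until it reaches the under-strand; the $B$-splicing is the other smoothing. The Tait sign $m_e$ of a crossing is $+$ if the $A$-splicing merges the two local black regions, and $-$ otherwise. The oriented sign $\sigma_e$ of a crossing is the usual sign of an oriented crossing (for sign $+$, the orientation-respecting smoothing is the $A$-splicing; for sign $-$, it is the $B$-splicing). The bi-weighted Tait graph $\mathbb{T}_\sigma(D)$ is the Tait graph (for a choice of checkerboard colouring) with weight $(m_e,\sigma_e)$ on each edge $e$. *)

theory Defs
  imports "HOL-Combinatorics.Combinatorics" "HOL-Library.Uprod"
begin

section \<open>Abstract graphs with loops and multiple edges\<close>

record ('v, 'e) mgraph =
  verts :: "'v set"
  edges :: "'e set"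
  ends :: "'e \<Rightarrow> 'v uprod"

definition graph :: "('v, 'e) mgraph \<Rightarrow> bool" where
  "graph G \<longleftrightarrow> (\<forall>e\<in>edges G. set_uprod (ends G e) \<subseteq> verts G)"

definition graph_isomorphic :: "('v, 'e) mgraph \<Rightarrow> ('w, 'f) mgraph \<Rightarrow> bool"  (infix "\<cong>\<^sub>G" 50) where
  "G \<cong>\<^sub>G K \<longleftrightarrow> (\<exists>f g. bij_betw f (verts G) (verts K) \<and> bij_betw g (edges G) (edges K) \<and>
     (\<forall>e\<in>edges G. ends K (g e) = map_uprod f (ends G e)))"

text \<open>A loop contributes to both summands.  Only used for finite graphs.\<close>
definition degree :: "('v, 'e) mgraph \<Rightarrow> 'v \<Rightarrow> nat" where
  "degree G v = card {e \<in> edges G. v \<in> set_uprod (ends G e)}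
              + card {e \<in> edges G. ends G e = Upair v v}"

definition reachable :: "('v, 'e) mgraph \<Rightarrow> ('v \<times> 'v) set" where
  "reachable G = {(u, v). \<exists>e\<in>edges G. ends G e = Upair u v}\<^sup>*"

definition connected_graph :: "('v, 'e) mgraph \<Rightarrow> bool" where
  "connected_graph G \<longleftrightarrow> verts G \<noteq> {} \<and> (\<forall>u\<in>verts G. \<forall>v\<in>verts G. (u, v) \<in> reachable G)"

definition eulerian :: "('v, 'e) mgraph \<Rightarrow> bool" where
  "eulerian G \<longleftrightarrow> connected_graph G \<and> (\<forall>v\<in>verts G. even (degree G v))"

definition induced_subgraph :: "('v, 'e) mgraph \<Rightarrow> 'v set \<Rightarrow> ('v, 'e) mgraph" where
  "induced_subgraph G W =
     \<lparr>verts = W, edges = {e \<in> edges G. set_uprod (ends G e) \<subseteq> W}, ends = ends G\<rparr>"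

definition components :: "('v, 'e) mgraph \<Rightarrow> ('v, 'e) mgraph set" where
  "components G = (\<lambda>v. induced_subgraph G {w \<in> verts G. (v, w) \<in> reachable G}) ` verts G"

definition delete_edges :: "('v, 'e) mgraph \<Rightarrow> 'e set \<Rightarrow> ('v, 'e) mgraph" where
  "delete_edges G B = \<lparr>verts = verts G, edges = edges G - B, ends = ends G\<rparr>"

definition disjoint_union ::
    "('v, 'e) mgraph \<Rightarrow> ('w, 'f) mgraph \<Rightarrow> ('v + 'w, 'e + 'f) mgraph" where
  "disjoint_union G K =
     \<lparr>verts = verts G <+> verts K, edges = edges G <+> edges K,
      ends = case_sum (\<lambda>e. map_uprod Inl (ends G e)) (\<lambda>e. map_uprod Inr (ends K e))\<rparr>"


section \<open>Plane graphs\<close>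

text \<open>
  A graph embedded in the oriented sphere with all regions discs is given, up to
  orientation-preserving homeomorphism, by its rotation system.  The darts are the half-edges;
  \<open>rev\<close> exchanges the two halves of an edge and \<open>rot\<close> sends a dart to the next dart
  counterclockwise around its vertex.  A dart is thought of as directed away from its vertex.

  The only plane graph without edges is a single point.  It is the map with no darts; since a
  vertex or face is represented by its set of darts, its only vertex and its only face are
  the empty set of darts (hence the case distinction in \<open>cells\<close>).
\<close>

record 'd plane_map =
  darts :: "'d set"
  rev :: "'d \<Rightarrow> 'd"
  rot :: "'d \<Rightarrow> 'd"

definition cells :: "('d \<Rightarrow> 'd set) \<Rightarrow> 'd set \<Rightarrow> 'd set set" where
  "cells c S = (if S = {} then {{}} else c ` S)"

definition vertex_of :: "('d, 'm) plane_map_scheme \<Rightarrow> 'd \<Rightarrow> 'd set" where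
  "vertex_of M d = orbit (rot M) d"

definition edge_of :: "('d, 'm) plane_map_scheme \<Rightarrow> 'd \<Rightarrow> 'd uprod" where
  "edge_of M d = Upair d (rev M d)"

text \<open>The underlying abstract graph.\<close>
definition graph_of :: "('d, 'm) plane_map_scheme \<Rightarrow> ('d set, 'd uprod) mgraph" where
  "graph_of M = \<lparr>verts = cells (vertex_of M) (darts M), edges = edge_of M ` darts M,
                 ends = map_uprod (vertex_of M)\<rparr>"

text \<open>
  Every dart has a face on its left.  The permutation \<open>inv (rot M) \<circ> rev M\<close> runs along the
  boundary of a face keeping the face on the left, hence counterclockwise as seen from inside
  the face.  So it is the rotation of the geometric dual, where \<open>d\<close>, regarded as a dart of the
  dual, starts in the face on the left of the dart \<open>d\<close> of \<open>M\<close> and crosses the edge of \<open>d\<close> from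
  left to right.  With this convention \<open>e\<close> and its dual edge are the same unordered pair of darts.
\<close>
definition dual :: "('d, 'm) plane_map_scheme \<Rightarrow> 'd plane_map" where
  "dual M = \<lparr>darts = darts M, rev = rev M, rot = inv (rot M) \<circ> rev M\<rparr>"

definition face_of :: "('d, 'm) plane_map_scheme \<Rightarrow> 'd \<Rightarrow> 'd set" where
  "face_of M d = vertex_of (dual M) d"

definition faces :: "('d, 'm) plane_map_scheme \<Rightarrow> 'd set set" where
  "faces M = cells (face_of M) (darts M)"

text \<open>The surface carrying the map is connected and, by Euler's formula, a sphere.\<close>
definition plane_graph :: "('d, 'm) plane_map_scheme \<Rightarrow> bool" where
  "plane_graph M \<longleftrightarrow>
     finite (darts M) \<and> rot M permutes darts M \<and> rev M permutes darts M \<and>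
     (\<forall>d\<in>darts M. rev M d \<noteq> d \<and> rev M (rev M d) = d) \<and>
     connected_graph (graph_of M) \<and>
     int (card (verts (graph_of M))) - int (card (edges (graph_of M))) + int (card (faces M)) = 2"

definition plane_iso ::
    "('d \<Rightarrow> 'c) \<Rightarrow> ('d, 'm) plane_map_scheme \<Rightarrow> ('c, 'n) plane_map_scheme \<Rightarrow> bool" where
  "plane_iso f M N \<longleftrightarrow> bij_betw f (darts M) (darts N) \<and>
     (\<forall>d\<in>darts M. f (rev M d) = rev N (f d) \<and> f (rot M d) = rot N (f d))"


section \<open>The graphs \<open>\<Phi>\<close> and \<open>\<Phi>\<^sup>\<circledast>\<close>\<close>

text \<open>Edges of \<open>H\<close> are tagged with \<open>Inl\<close>, edges of the dual with \<open>Inr\<close>.\<close>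
definition Phi ::
    "('d, 'm) plane_map_scheme \<Rightarrow> 'd uprod set \<Rightarrow> ('d set + 'd set, 'd uprod + 'd uprod) mgraph" where
  "Phi H A = delete_edges (disjoint_union (graph_of H) (graph_of (dual H)))
               (Inl ` (edges (graph_of H) - A) \<union> Inr ` A)"

text \<open>
  The standard immersion of \<open>H\<close> and its dual cuts the sphere into quadrangles, one for each
  corner of \<open>H\<close>: the quadrangle of the dart \<open>d\<close> has the edges of \<open>d\<close> and of \<open>rot H d\<close> at
  its vertex on its boundary, and lies in the face on the left of \<open>d\<close>.  Across the half of the
  edge of \<open>d\<close> next to the vertex of \<open>d\<close>, it is adjacent to the quadrangle of \<open>inv (rot H) d\<close>;
  across the half of the dual edge of \<open>d\<close> in the face on the left of \<open>d\<close>, it is adjacent to the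
  quadrangle of \<open>inv (rot H) (rev H d)\<close>.  Let \<open>X\<close> consist of edges of \<open>H\<close> and of its dual, at
  least one from every pair of dual edges.  Then the complement in the sphere of \<open>X\<close> and all
  vertices is a union of open quadrangles and open half-edges, so its regions are the classes of
  quadrangles connected through half-edges of edges outside \<open>X\<close>.
  (If there are no darts, the complement of the two vertices is one region.)
\<close>
definition quad_adj ::
    "('d, 'm) plane_map_scheme \<Rightarrow> ('d uprod + 'd uprod) set \<Rightarrow> ('d \<times> 'd) set" where
  "quad_adj H X =
     {(d, inv (rot H) d) | d. d \<in> darts H \<and> Inl (edge_of H d) \<notin> X} \<union>
     {(d, inv (rot H) (rev H d)) | d. d \<in> darts H \<and> Inr (edge_of H d) \<notin> X}"

definition region_of ::
    "('d, 'm) plane_map_scheme \<Rightarrow> ('d uprod + 'd uprod) set \<Rightarrow> 'd \<Rightarrow> 'd set" where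
  "region_of H X d = (quad_adj H X \<union> (quad_adj H X)\<inverse>)\<^sup>* `` {d}"

text \<open>
  The two quadrangles of \<open>d\<close> and \<open>rev H d\<close> lie diagonally opposite at the crossing of the edge of
  \<open>d\<close> with its dual edge, so they lie on different sides of either of these two edges.  If
  exactly one of the two belongs to \<open>\<Phi>\<close>, the regions on its two sides are the regions of
  these two quadrangles.
\<close>
definition circled_dual ::
    "('d, 'm) plane_map_scheme \<Rightarrow> ('d set + 'd set, 'd uprod + 'd uprod) mgraph
      \<Rightarrow> ('d set, 'd uprod + 'd uprod) mgraph" where
  "circled_dual H F =
     \<lparr>verts = cells (region_of H (edges F)) (darts H), edges = edges F,
      ends = case_sum (map_uprod (region_of H (edges F))) (map_uprod (region_of H (edges F)))\<rparr>"


section \<open>Oriented link diagrams\<close>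

text \<open>
  A diagram is a 4-regular plane graph whose vertices are the crossings.  A strand runs straight
  through a crossing, from a dart \<open>h\<close> to the opposite dart \<open>rot D (rot D h)\<close>.  The set
  \<open>over\<close> contains the darts on over-strands, and \<open>out\<close> those along which the orientation
  leaves the crossing.  The diagram without darts stands for the only connected
  diagram without crossings, a simple closed curve (and not for a point).
\<close>
record 'd link_diagram = "'d plane_map" +
  over :: "'d set"
  out :: "'d set"

abbreviation opp :: "('d, 'm) plane_map_scheme \<Rightarrow> 'd \<Rightarrow> 'd" where
  "opp D h \<equiv> rot D (rot D h)"

definition oriented_link_diagram :: "'d link_diagram \<Rightarrow> bool" where
  "oriented_link_diagram D \<longleftrightarrow>
     plane_graph D \<and> over D \<subseteq> darts D \<and> out D \<subseteq> darts D \<and>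
     (\<forall>h\<in>darts D. card (vertex_of D h) = 4 \<and>
        (rot D h \<in> over D \<longleftrightarrow> h \<notin> over D) \<and>
        (opp D h \<in> out D \<longleftrightarrow> h \<notin> out D) \<and>
        (rev D h \<in> out D \<longleftrightarrow> h \<notin> out D))"

definition crossings :: "'d link_diagram \<Rightarrow> 'd set set" where
  "crossings D = vertex_of D ` darts D"

text \<open>
  The orientation-respecting smoothing joins each incoming dart to the outgoing dart next to it.
  A Seifert circle is represented by the darts it runs through.
\<close>
definition seifert_adj :: "'d link_diagram \<Rightarrow> ('d \<times> 'd) set" where
  "seifert_adj D =
     {(h, rev D h) | h. h \<in> darts D} \<union>
     {(h, rot D h) | h. h \<in> darts D \<and> (h \<in> out D) \<noteq> (rot D h \<in> out D)}"

definition seifert_circle :: "'d link_diagram \<Rightarrow> 'd \<Rightarrow> 'd set" where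
  "seifert_circle D h = (seifert_adj D \<union> (seifert_adj D)\<inverse>)\<^sup>* `` {h}"

text \<open>Opposite darts at a crossing lie on different arcs of its smoothing.\<close>
definition seifert_graph :: "'d link_diagram \<Rightarrow> ('d set, 'd set) mgraph" where
  "seifert_graph D =
     \<lparr>verts = cells (seifert_circle D) (darts D), edges = crossings D,
      ends = (\<lambda>c. THE u. \<exists>h\<in>c. u = map_uprod (seifert_circle D) (Upair h (opp D h)))\<rparr>"


section \<open>The bi-weighted Tait graph\<close>

text \<open>A colouring is given by its set of black regions.\<close>
definition checkerboard :: "'d link_diagram \<Rightarrow> 'd set set \<Rightarrow> bool" where
  "checkerboard D B \<longleftrightarrow> B \<subseteq> faces D \<and>
     (\<forall>h\<in>darts D. face_of D h \<in> B \<longleftrightarrow> face_of D (rev D h) \<notin> B)"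

text \<open>
  The dart \<open>h\<close> also names the corner between \<open>h\<close> and \<open>rot D h\<close>, which lies in the region on
  the left of \<open>h\<close>.  The darts of the Tait graph are the black corners; the edge through a crossing
  joins two opposite corners, and the corners of a black region appear counterclockwise in the
  order given by \<open>inv (rot D) \<circ> rev D\<close>.
\<close>
definition black_corners :: "'d link_diagram \<Rightarrow> 'd set set \<Rightarrow> 'd set" where
  "black_corners D B = {h \<in> darts D. face_of D h \<in> B}"

definition tait_graph :: "'d link_diagram \<Rightarrow> 'd set set \<Rightarrow> 'd plane_map" where
  "tait_graph D B =
     \<lparr>darts = black_corners D B,
      rev = perm_restrict (opp D) (black_corners D B),
      rot = perm_restrict (inv (rot D) \<circ> rev D) (black_corners D B)\<rparr>"

datatype sign = Plus | Minus

text \<open>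
  Rotating the over-strand counterclockwise sweeps the corners named by the over-darts, so
  these are the local regions merged by the \<open>A\<close>-splicing.
\<close>
definition tait_sign :: "'d link_diagram \<Rightarrow> 'd set set \<Rightarrow> 'd set \<Rightarrow> sign" where
  "tait_sign D B c = (if \<forall>h \<in> c \<inter> over D. face_of D h \<in> B then Plus else Minus)"

text \<open>
  A crossing is positive if the outgoing under-dart follows the outgoing over-dart counterclockwise.
\<close>
definition crossing_sign :: "'d link_diagram \<Rightarrow> 'd set \<Rightarrow> sign" where
  "crossing_sign D c = (if \<forall>h \<in> c \<inter> over D \<inter> out D. rot D h \<in> out D then Plus else Minus)"

definition crossing_of_edge :: "'d link_diagram \<Rightarrow> 'd uprod \<Rightarrow> 'd set" where
  "crossing_of_edge D e = (\<Union>h\<in>set_uprod e. vertex_of D h)"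

definition tait_weight :: "'d link_diagram \<Rightarrow> 'd set set \<Rightarrow> 'd uprod \<Rightarrow> sign \<times> sign" where
  "tait_weight D B e =
     (tait_sign D B (crossing_of_edge D e), crossing_sign D (crossing_of_edge D e))"

definition equal_weight_edges :: "'d link_diagram \<Rightarrow> 'd set set \<Rightarrow> 'd uprod set" where
  "equal_weight_edges D B = {e \<in> edges (graph_of (tait_graph D B)).
     tait_weight D B e = (Plus, Plus) \<or> tait_weight D B e = (Minus, Minus)}"

end

theory Submission
  imports Defs
begin

text \<open>
  A crossing of a diagram is an edge of its Tait graph \<open>H\<close>, and the smoothing that respects the
  orientation either separates the two black corners or merges them.  The edges of equal weights
  are exactly those where it merges them (lemma \<open>equal_weight_iff\<close>).  Hence the Seifert circles run
  parallel to the edges of \<open>\<Phi>\<close>: along both sides of \<open>e\<close> for \<open>e \<in> A\<close>, and along both sides of the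
  dual edge otherwise.
  A diagram edge lies in one quadrangle of the standard immersion, and going through a smoothed
  crossing means to pass from that quadrangle to an adjacent one across a half-edge outside
  \<open>\<Phi>\<close>; all half-edges outside \<open>\<Phi>\<close> arise in this way.  So the Seifert circles correspond
  to the regions of \<open>\<Phi>\<close>, a crossing joins the regions on the two sides of its edge of
  \<open>\<Phi>\<close>, and the Seifert graph is \<open>\<Phi>\<^sup>\<circledast>\<close> (theorem
  \<open>seifert_graph_isomorphic_circled_dual\<close>).

  What remains is which \<open>A\<close> come from an orientation.  Let a quadrangle have the colour \<open>True\<close> if
  its diagram edge runs counterclockwise around the vertex of \<open>H\<close>.  The two arcs of the smoothing
  at a crossing run in the same direction along an edge of \<open>\<Phi>\<close>, on different sides, so the colour
  changes exactly across the edges of \<open>\<Phi>\<close>.  Thus an orientation is the same thing as a 2-colouring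
  of the regions of \<open>\<Phi>\<close>, and on the sphere an embedded graph has such a colouring if and
  only if all its degrees are even (lemmas \<open>Phi_eulerian_if_colouring\<close> and
  \<open>colouring_if_Phi_eulerian\<close>).  The topological input is that every even edge set of a plane graph
  is the boundary of a set of faces (theorem \<open>even_edge_set_bounds\<close>); it also yields checkerboard
  colourings.

  A diagram is the medial graph of its Tait graph.  The locale \<open>medial\<close> describes this relation
  between two maps, so the same lemmas serve to analyse a given diagram and to build one from a
  plane graph.
\<close>

section \<open>Isomorphism, components and degrees of abstract graphs\<close>

lemma graph_isomorphic_trans:
  assumes "G \<cong>\<^sub>G K" and "K \<cong>\<^sub>G L"
  shows "G \<cong>\<^sub>G L"
proof -
  obtain f g where fg: "bij_betw f (verts G) (verts K)" "bij_betw g (edges G) (edges K)"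
    "\<And>e. e \<in> edges G \<Longrightarrow> ends K (g e) = map_uprod f (ends G e)"
    using assms(1) unfolding graph_isomorphic_def by blast
  obtain f' g' where fg': "bij_betw f' (verts K) (verts L)" "bij_betw g' (edges K) (edges L)"
    "\<And>e. e \<in> edges K \<Longrightarrow> ends L (g' e) = map_uprod f' (ends K e)"
    using assms(2) unfolding graph_isomorphic_def by blast
  have "ends L ((g' \<circ> g) e) = map_uprod (f' \<circ> f) (ends G e)" if "e \<in> edges G" for e
    using fg(3)[OF that] fg'(3)[OF bij_betw_apply[OF fg(2) that]] by (simp add: uprod.map_comp)
  then show ?thesis
    unfolding graph_isomorphic_def
    using bij_betw_trans[OF fg(1) fg'(1)] bij_betw_trans[OF fg(2) fg'(2)] by blast
qed

lemma graph_isomorphic_sym: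
  assumes "graph G" and "G \<cong>\<^sub>G K"
  shows "K \<cong>\<^sub>G G"
proof -
  obtain f g where fg: "bij_betw f (verts G) (verts K)" "bij_betw g (edges G) (edges K)"
    "\<And>e. e \<in> edges G \<Longrightarrow> ends K (g e) = map_uprod f (ends G e)"
    using assms(2) unfolding graph_isomorphic_def by blast
  let ?f = "inv_into (verts G) f" and ?g = "inv_into (edges G) g"
  have "ends G (?g e) = map_uprod ?f (ends K e)" if "e \<in> edges K" for e
  proof -
    have e: "?g e \<in> edges G" "g (?g e) = e"
      using that fg(2) by (auto simp: bij_betw_def inv_into_into f_inv_into_f)
    have "map_uprod ?f (ends K e) = map_uprod (?f \<circ> f) (ends G (?g e))"
      using fg(3)[OF e(1)] e(2) by (simp add: uprod.map_comp)
    also have "\<dots> = map_uprod id (ends G (?g e))"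
    proof (rule uprod.map_cong0)
      fix z assume "z \<in> set_uprod (ends G (?g e))"
      then have "z \<in> verts G" using e(1) assms(1) unfolding graph_def by blast
      then show "(?f \<circ> f) z = id z" using fg(1) by (simp add: bij_betw_def)
    qed
    finally show ?thesis by (simp add: uprod.map_id)
  qed
  then show ?thesis
    unfolding graph_isomorphic_def
    using bij_betw_inv_into[OF fg(1)] bij_betw_inv_into[OF fg(2)] by blast
qed

lemma reachable_sym:
  assumes "(u, v) \<in> reachable G"
  shows "(v, u) \<in> reachable G"
proof -
  have comm: "Upair x y = Upair y x" for x y :: 'a by simp
  have "sym {(u, v). \<exists>e\<in>edges G. ends G e = Upair u v}"
    unfolding sym_def by (simp add: comm[of _ _])
  then show ?thesis
    using assms unfolding reachable_def by (rule symD[OF sym_rtrancl])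
qed

lemma reachable_trans: "(u, v) \<in> reachable G \<Longrightarrow> (v, w) \<in> reachable G \<Longrightarrow> (u, w) \<in> reachable G"
  unfolding reachable_def by (rule rtrancl_trans)

lemma reachable_edge: "e \<in> edges G \<Longrightarrow> ends G e = Upair u v \<Longrightarrow> (u, v) \<in> reachable G"
  unfolding reachable_def by blast

lemma reachable_refl: "(u, u) \<in> reachable G"
  unfolding reachable_def by simp

text \<open>
  An edge that meets a component lies in it, so passing to the component of a vertex changes
  neither its degree nor what can be reached from it.
\<close>
lemma components_eulerian_iff:
  assumes "graph G"
  shows "(\<forall>C\<in>components G. eulerian C) \<longleftrightarrow> (\<forall>v\<in>verts G. even (degree G v))"
proof -
  have comp: "eulerian (induced_subgraph G W) \<longleftrightarrow> (\<forall>w\<in>W. even (degree G w))"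
    if v: "v \<in> verts G" and W: "W = {w \<in> verts G. (v, w) \<in> reachable G}" for v W
  proof -
    let ?C = "induced_subgraph G W"
    have in_W: "set_uprod (ends G e) \<subseteq> W"
      if "e \<in> edges G" "w \<in> W" "w \<in> set_uprod (ends G e)" for e w
    proof -
      obtain x y where xy: "ends G e = Upair x y" by (cases "ends G e")
      then have "(x, y) \<in> reachable G" "(y, x) \<in> reachable G"
        using reachable_edge[OF that(1) xy] reachable_sym[OF reachable_edge[OF that(1) xy]] by simp_all
      moreover have "x \<in> verts G" "y \<in> verts G" using assms that(1) xy by (auto simp: graph_def)
      moreover have "(v, x) \<in> reachable G \<or> (v, y) \<in> reachable G"
        using that(2,3) xy by (auto simp: W)
      ultimately have "(v, x) \<in> reachable G \<and> (v, y) \<in> reachable G"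
        using reachable_trans[of v x G y] reachable_trans[of v y G x] by blast
      then show ?thesis using \<open>x \<in> verts G\<close> \<open>y \<in> verts G\<close> xy by (simp add: W)
    qed
    have "degree ?C w = degree G w" if "w \<in> W" for w
    proof -
      have "{e \<in> edges ?C. w \<in> set_uprod (ends ?C e)} = {e \<in> edges G. w \<in> set_uprod (ends G e)}"
        using in_W that by (auto simp: induced_subgraph_def)
      moreover have "{e \<in> edges ?C. ends ?C e = Upair w w} = {e \<in> edges G. ends G e = Upair w w}"
        using that by (auto simp: induced_subgraph_def)
      ultimately show ?thesis by (simp add: degree_def)
    qed
    moreover have "connected_graph ?C"
    proof -
      have reach: "(v, w) \<in> reachable ?C \<and> w \<in> verts G" if "(v, w) \<in> reachable G" for w
        using that unfolding reachable_def[of G]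
      proof (induction rule: rtrancl_induct)
        case base
        show ?case using v by (simp add: reachable_refl)
      next
        case (step y z)
        then obtain e where e: "e \<in> edges G" "ends G e = Upair y z" by blast
        have "y \<in> W" using step by (simp add: W reachable_def[of G])
        then have "e \<in> edges ?C" "ends ?C e = Upair y z" "z \<in> verts G"
          using in_W[OF e(1), of y] e by (auto simp: induced_subgraph_def W)
        then show ?case using step.IH reachable_trans[OF _ reachable_edge, of v y ?C e z] by blast
      qed
      have "v \<in> W" using v by (simp add: W reachable_refl)
      moreover have "(u, w) \<in> reachable ?C" if "u \<in> W" "w \<in> W" for u w
      proof (rule reachable_trans)
        show "(u, v) \<in> reachable ?C" using that(1) reach by (intro reachable_sym[of v u]) (simp add: W)
        show "(v, w) \<in> reachable ?C" using that(2) reach by (simp add: W)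
      qed
      ultimately show ?thesis by (auto simp: connected_graph_def induced_subgraph_def)
    qed
    ultimately show ?thesis by (auto simp: eulerian_def induced_subgraph_def)
  qed
  then have "(\<forall>C\<in>components G. eulerian C) \<longleftrightarrow>
      (\<forall>v\<in>verts G. \<forall>w\<in>{w \<in> verts G. (v, w) \<in> reachable G}. even (degree G w))"
    unfolding components_def by simp
  then show ?thesis using reachable_refl[of _ G] by blast
qed

section \<open>Parity and counting\<close>

lemma odd_card_sym_diff:
  assumes "finite P" "finite Q"
  shows "odd (card (sym_diff P Q)) \<longleftrightarrow> odd (card P) \<noteq> odd (card Q)"
proof -
  have "card (sym_diff P Q) + 2 * card (P \<inter> Q) = card P + card Q"
  proof -
    have "card P = card (P - Q) + card (P \<inter> Q)" "card Q = card (Q - P) + card (P \<inter> Q)"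
      using assms card_Diff_subset_Int[of P Q] card_Diff_subset_Int[of Q P]
        card_mono[of P "P \<inter> Q"] card_mono[of Q "P \<inter> Q"] by (auto simp: Int_commute)
    moreover have "card (sym_diff P Q) = card (P - Q) + card (Q - P)"
      using assms by (intro card_Un_disjoint) auto
    ultimately show ?thesis by simp
  qed
  then show ?thesis by presburger
qed

lemma card_eq_fibres:
  assumes "finite S" and "\<And>y. y \<in> f ` S \<Longrightarrow> card {x \<in> S. f x = y} = k"
  shows "card S = card (f ` S) * k"
proof -
  have "card S = (\<Sum>y\<in>f ` S. card {x \<in> S. f x = y})"
    using sum.image_gen[OF assms(1), of "\<lambda>_. 1::nat" f] by simp
  then show ?thesis using assms(2) by simp
qed

text \<open>
  Symmetric difference makes a power set a vector space over the field with two elements.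
  This is the rank-nullity theorem there: each fibre is a translate of the kernel.
\<close>
lemma card_image_mult_card_kernel:
  fixes f :: "'a set \<Rightarrow> 'b set"
  assumes "finite A" and add: "\<And>X Y. X \<subseteq> A \<Longrightarrow> Y \<subseteq> A \<Longrightarrow> f (sym_diff X Y) = sym_diff (f X) (f Y)"
  shows "card (f ` Pow A) * card {X \<in> Pow A. f X = {}} = 2 ^ card A"
proof -
  have "card {X \<in> Pow A. f X = Y} = card {X \<in> Pow A. f X = {}}" if Y: "Y \<in> f ` Pow A" for Y
  proof -
    obtain X0 where X0: "X0 \<subseteq> A" "f X0 = Y" using Y by auto
    have inv: "sym_diff (sym_diff X X0) X0 = X" for X :: "'a set" by auto
    have "bij_betw (\<lambda>X. sym_diff X X0) {X \<in> Pow A. f X = Y} {X \<in> Pow A. f X = {}}"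
    proof (rule bij_betw_byWitness[where f' = "\<lambda>X. sym_diff X X0"])
      show "(\<lambda>X. sym_diff X X0) ` {X \<in> Pow A. f X = Y} \<subseteq> {X \<in> Pow A. f X = {}}"
        using add[OF _ X0(1)] X0 by auto
      show "(\<lambda>X. sym_diff X X0) ` {X \<in> Pow A. f X = {}} \<subseteq> {X \<in> Pow A. f X = Y}"
        using add[OF _ X0(1)] X0 by auto
    qed (simp_all only: inv, simp_all)
    then show ?thesis by (rule bij_betw_same_card)
  qed
  then show ?thesis
    using card_eq_fibres[of "Pow A" f] assms(1) by (simp add: card_Pow)
qed

section \<open>Orbits of permutations\<close>

lemma permutes_orbit_self: "p permutes S \<Longrightarrow> finite S \<Longrightarrow> x \<in> orbit p x"
  by (rule permutation_self_in_orbit) (auto simp: permutation_permutes)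

lemma permutes_orbit_step: "p permutes S \<Longrightarrow> finite S \<Longrightarrow> orbit p (p x) = orbit p x"
  by (rule permutation_orbit_step) (auto simp: permutation_permutes)

lemma permutes_orbit_eq: "p permutes S \<Longrightarrow> finite S \<Longrightarrow> y \<in> orbit p x \<Longrightarrow> orbit p y = orbit p x"
  by (rule orbit_cyclic_eq3[OF cyclic_on_orbit])

lemma permutes_image_orbit:
  assumes "p permutes S" "finite S"
  shows "p ` orbit p x = orbit p x"
proof -
  have "p ` orbit p x = orbit p (p x)"
    using permutes_orbit_self[OF assms] by (rule orbit_inverse) simp
  then show ?thesis using permutes_orbit_step[OF assms] by simp
qed

lemma permutes_closed_inv:
  assumes "p permutes S" "finite S" "T \<subseteq> S" "p ` T \<subseteq> T" "x \<in> T"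
  shows "inv p x \<in> T"
proof -
  have "p ` T = T"
    using assms by (intro endo_inj_surj permutes_inj_on) (auto intro: finite_subset)
  then obtain y where "y \<in> T" "x = p y" using assms(5) by blast
  then show ?thesis using assms(1) by (simp add: permutes_inverses)
qed

text \<open>Walking once around a cycle, a truth value changes an even number of times.\<close>
lemma even_changes_on_orbit:
  fixes P :: "'a \<Rightarrow> bool"
  assumes "p permutes S" "finite S" "x \<in> S"
  shows "even (card {y \<in> orbit p x. P y \<noteq> P (p y)})"
proof -
  let ?O = "orbit p x"
  have fin: "finite ?O" using permutes_orbit_subset[OF assms(1,3)] assms(2) by (rule finite_subset)
  have "p ` {y \<in> ?O. P (p y)} = {y \<in> ?O. P y}"
    using permutes_image_orbit[OF assms(1,2), of x] by (auto intro: orbit.step)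
  then have "card {y \<in> ?O. P y} = card {y \<in> ?O. P (p y)}"
    using card_image[OF permutes_inj_on[OF assms(1)], of "{y \<in> ?O. P (p y)}"] by simp
  moreover have "{y \<in> ?O. P y \<noteq> P (p y)} = sym_diff {y \<in> ?O. P y} {y \<in> ?O. P (p y)}"
    by auto
  ultimately show ?thesis 
    using odd_card_sym_diff[of "{y \<in> ?O. P y}" "{y \<in> ?O. P (p y)}"] fin by simp
qed

text \<open>
  Conversely, a prescribed set of places of change that is even on every cycle is realised: in
  each cycle choose a start, where the value is \<open>False\<close>, and count changes modulo two.  Evenness
  is what makes the value return to \<open>False\<close> when the cycle closes up.
\<close>
lemma exists_changes_on_orbits:
  assumes p: "p permutes S" "finite S"
    and ev: "\<And>x. x \<in> S \<Longrightarrow> even (card {y \<in> orbit p x. a y})"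
  shows "\<exists>P :: 'a \<Rightarrow> bool. \<forall>x\<in>S. a x \<longleftrightarrow> P x \<noteq> P (p x)"
proof -
  define start where "start x = (SOME y. y \<in> orbit p x)" for x
  define n where "n x = funpow_dist p (start x) x" for x
  \<comment> \<open>\<open>n x\<close> steps lead from the start of its cycle to \<open>x\<close>; \<open>P x\<close> counts the changes on the way.\<close>
  define P where "P x \<longleftrightarrow> odd (card {i. i < n x \<and> a ((p ^^ i) (start x))})" for x
  have "a x \<longleftrightarrow> P x \<noteq> P (p x)" if x: "x \<in> S" for x
  proof -
    define s where "s = start x"
    have s: "s \<in> orbit p x"
      unfolding s_def start_def using permutes_orbit_self[OF p] by (rule someI)
    then have O: "orbit p s = orbit p x" by (rule permutes_orbit_eq[OF p])
    have x_in: "x \<in> orbit p s" using O permutes_orbit_self[OF p] by simp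
    have start_p: "start (p x) = s" by (simp add: s_def start_def permutes_orbit_step[OF p])
    have nx: "(p ^^ n x) s = x"
      unfolding n_def s_def[symmetric] by (rule funpow_dist_prop[OF x_in])
    have step: "{i. i < Suc (n x) \<and> a ((p ^^ i) s)} =
        (if a x then insert (n x) {i. i < n x \<and> a ((p ^^ i) s)} else {i. i < n x \<and> a ((p ^^ i) s)})"
      using nx by (auto simp: less_Suc_eq)
    have odd_step: "odd (card {i. i < Suc (n x) \<and> a ((p ^^ i) s)}) \<longleftrightarrow> (P x \<noteq> a x)"
      by (simp add: P_def s_def[symmetric] step)
    show ?thesis
    proof (cases "p x = s")
      case True
      have "orbit p s = (\<lambda>i. (p ^^ i) s) ` {i. i < Suc (n x)}"
      proof -
        have "(p ^^ Suc (n x)) s = s" using nx True by simp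
        from orbit_altdef_bounded[OF this] show ?thesis by auto
      qed
      moreover have inj: "inj_on (\<lambda>i. (p ^^ i) s) {i. i < Suc (n x)}"
        using inj_on_funpow_dist[OF x_in]
        by (rule inj_on_subset) (auto simp: n_def s_def)
      ultimately have img: "{y \<in> orbit p x. a y} = (\<lambda>i. (p ^^ i) s) ` {i. i < Suc (n x) \<and> a ((p ^^ i) s)}"
        using O by auto
      have crd: "card ((\<lambda>i. (p ^^ i) s) ` {i. i < Suc (n x) \<and> a ((p ^^ i) s)}) =
          card {i. i < Suc (n x) \<and> a ((p ^^ i) s)}"
        by (rule card_image[OF inj_on_subset[OF inj]]) blast
      have "even (card {i. i < Suc (n x) \<and> a ((p ^^ i) s)})"
        using ev[OF x] unfolding img crd .
      moreover have "\<not> P (p x)"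
        using True start_p by (simp add: P_def n_def funpow_dist_0)
      ultimately show ?thesis using odd_step by blast
    next
      case False
      have "n (p x) = Suc (n x)"
      proof -
        have px: "p x \<in> orbit p s" using x_in by (rule orbit.step)
        define m where "m = funpow_dist p s (p x)"
        have m: "(p ^^ m) s = p x" unfolding m_def by (rule funpow_dist_prop[OF px])
        then obtain m' where m': "m = Suc m'" using False by (cases m) auto
        have "m \<le> Suc (n x)"
          using nx funpow_dist_least[of "Suc (n x)" p s "p x"] unfolding m_def
          by (auto simp: not_less[symmetric])
        moreover have "(p ^^ m') s = x"
          using m m' permutes_inj[OF p(1)] by (auto dest: injD)
        then have "n x \<le> m'"
          using funpow_dist_least[of m' p s x] unfolding n_def s_def
          by (auto simp: not_less[symmetric])
        ultimately show ?thesis using m' by (simp add: n_def start_p m_def)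
      qed
      then have "P (p x) \<longleftrightarrow> P x \<noteq> a x" using odd_step by (simp add: P_def[of "p x"] start_p)
      then show ?thesis by blast
    qed
  qed
  then have "\<forall>x\<in>S. a x \<longleftrightarrow> P x \<noteq> P (p x)" by simp
  then show ?thesis by (rule exI[of _ P])
qed

section \<open>Combinatorial maps\<close>

text \<open>
  The conditions of \<^const>\<open>plane_graph\<close> that concern single darts; they define a cellularly embedded
  graph on some closed oriented surface, which may be disconnected and of higher genus.
\<close>
locale combinatorial_map =
  fixes M :: "('d, 'm) plane_map_scheme"
  assumes finite_darts [simp]: "finite (darts M)"
    and rot_permutes: "rot M permutes darts M"
    and rev_permutes: "rev M permutes darts M"
    and rev_neq: "\<And>d. d \<in> darts M \<Longrightarrow> rev M d \<noteq> d"
    and rev_rev_dart: "\<And>d. d \<in> darts M \<Longrightarrow> rev M (rev M d) = d"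

lemma dual_simps [simp]:
  "darts (dual M) = darts M" "rev (dual M) = rev M" "rot (dual M) d = inv (rot M) (rev M d)"
  by (simp_all add: dual_def)

lemma plane_graph_iff:
  "plane_graph M \<longleftrightarrow> combinatorial_map M \<and> connected_graph (graph_of M) \<and>
     int (card (verts (graph_of M))) - int (card (edges (graph_of M))) + int (card (faces M)) = 2"
  unfolding plane_graph_def combinatorial_map_def by blast

context combinatorial_map
begin

lemma rev_rev [simp]: "rev M (rev M d) = d"
  by (cases "d \<in> darts M") (simp_all add: rev_rev_dart permutes_not_in[OF rev_permutes])

lemma rot_in_darts [simp]: "rot M d \<in> darts M \<longleftrightarrow> d \<in> darts M"
  by (rule permutes_in_image[OF rot_permutes])

lemma rev_in_darts [simp]: "rev M d \<in> darts M \<longleftrightarrow> d \<in> darts M"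
  by (rule permutes_in_image[OF rev_permutes])

lemma inv_rot_in_darts [simp]: "inv (rot M) d \<in> darts M \<longleftrightarrow> d \<in> darts M"
  by (rule permutes_in_image[OF permutes_inv[OF rot_permutes]])

lemma rot_inv_rot [simp]: "rot M (inv (rot M) d) = d" "inv (rot M) (rot M d) = d"
  using permutes_inverses[OF rot_permutes] by simp_all

lemma rot_eq_iff [simp]: "rot M c = rot M d \<longleftrightarrow> c = d"
  using permutes_inj[OF rot_permutes] by (auto dest: injD)

lemma combinatorial_map_dual: "combinatorial_map (dual M)"
proof
  show "rot (dual M) permutes darts (dual M)"
    unfolding dual_def by (simp add: permutes_compose[OF rev_permutes permutes_inv[OF rot_permutes]])
qed (use rev_permutes rev_neq in simp_all)

lemma vertex_of_self [simp]: "d \<in> vertex_of M d"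
  unfolding vertex_of_def by (rule permutes_orbit_self[OF rot_permutes finite_darts])

lemma vertex_of_rot [simp]: "vertex_of M (rot M d) = vertex_of M d"
  unfolding vertex_of_def by (rule permutes_orbit_step[OF rot_permutes finite_darts])

lemma vertex_of_eq_iff: "vertex_of M c = vertex_of M d \<longleftrightarrow> c \<in> vertex_of M d"
  using permutes_orbit_eq[OF rot_permutes finite_darts] vertex_of_self
  unfolding vertex_of_def by blast

lemma vertex_of_subset: "d \<in> darts M \<Longrightarrow> vertex_of M d \<subseteq> darts M"
  unfolding vertex_of_def by (rule permutes_orbit_subset[OF rot_permutes])

lemma finite_vertex_of: "d \<in> darts M \<Longrightarrow> finite (vertex_of M d)"
  using vertex_of_subset finite_darts by (rule finite_subset)

lemma face_of_eq_iff: "face_of M c = face_of M d \<longleftrightarrow> c \<in> face_of M d"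
  unfolding face_of_def by (rule combinatorial_map.vertex_of_eq_iff[OF combinatorial_map_dual])

lemma face_of_self [simp]: "d \<in> face_of M d"
  unfolding face_of_def by (rule combinatorial_map.vertex_of_self[OF combinatorial_map_dual])

lemma face_of_subset: "d \<in> darts M \<Longrightarrow> face_of M d \<subseteq> darts M"
  unfolding face_of_def using combinatorial_map.vertex_of_subset[OF combinatorial_map_dual] by simp

lemma face_of_dual_rot [simp]: "face_of M (inv (rot M) (rev M d)) = face_of M d"
  unfolding face_of_def
  using combinatorial_map.vertex_of_rot[OF combinatorial_map_dual, of d] by simp

lemma face_of_inv_rot: "face_of M (inv (rot M) d) = face_of M (rev M d)"
  using face_of_dual_rot[of "rev M d"] by simp

lemma edge_of_rev [simp]: "edge_of M (rev M d) = edge_of M d"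
  by (auto simp: edge_of_def)

lemma edge_of_eq_iff: "edge_of M c = edge_of M d \<longleftrightarrow> c = d \<or> c = rev M d"
  by (auto simp: edge_of_def)

lemma card_darts: "card (darts M) = card (edge_of M ` darts M) * 2"
proof (rule card_eq_fibres)
  fix e assume "e \<in> edge_of M ` darts M"
  then obtain d where d: "d \<in> darts M" "e = edge_of M d" by blast
  then have "{c \<in> darts M. edge_of M c = e} = {d, rev M d}" by (auto simp: edge_of_eq_iff)
  then show "card {c \<in> darts M. edge_of M c = e} = 2" using rev_neq[OF d(1)] by auto
qed simp

lemma verts_graph_of: "darts M \<noteq> {} \<Longrightarrow> verts (graph_of M) = vertex_of M ` darts M"
  by (simp add: graph_of_def cells_def)

lemma edges_graph_of: "edges (graph_of M) = edge_of M ` darts M"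
  by (simp add: graph_of_def)

lemma ends_graph_of [simp]: "ends (graph_of M) (edge_of M d) = Upair (vertex_of M d) (vertex_of M (rev M d))"
  by (simp add: graph_of_def edge_of_def)

lemma faces_eq: "darts M \<noteq> {} \<Longrightarrow> faces M = face_of M ` darts M"
  by (simp add: faces_def cells_def)

lemma graph_graph_of: "graph (graph_of M)"
  by (auto simp: graph_def graph_of_def edge_of_def cells_def)

text \<open>
  Connectedness in terms of darts; in this form it is symmetric in a map and its dual, and can
  be pulled back and pushed forward along maps between sets of darts.
\<close>
lemma connected_iff:
  "connected_graph (graph_of M) \<longleftrightarrow>
     (\<forall>T. T \<subseteq> darts M \<longrightarrow> T \<noteq> {} \<longrightarrow> rot M ` T \<subseteq> T \<longrightarrow> rev M ` T \<subseteq> T \<longrightarrow> T = darts M)"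
proof (intro iffI allI impI)
  fix T assume con: "connected_graph (graph_of M)"
    and T: "T \<subseteq> darts M" "T \<noteq> {}" "rot M ` T \<subseteq> T" "rev M ` T \<subseteq> T"
  obtain t where t: "t \<in> T" using T(2) by blast
  have orb: "vertex_of M c \<subseteq> T" if "c \<in> T" for c
  proof
    fix x assume "x \<in> vertex_of M c"
    then show "x \<in> T" unfolding vertex_of_def by induction (use that T(3) in auto)
  qed
  have nonempty: "darts M \<noteq> {}" using t T(1) by blast
  have "d \<in> T" if d: "d \<in> darts M" for d
  proof -
    have "(vertex_of M t, vertex_of M d) \<in> reachable (graph_of M)"
      using con d t T(1) by (auto simp: connected_graph_def verts_graph_of[OF nonempty])
    then have "vertex_of M d \<subseteq> T" unfolding reachable_def
    proof (induction rule: rtrancl_induct)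
      case base
      show ?case using orb[OF t] .
    next
      case (step y z)
      then obtain c where c: "c \<in> darts M"
        "Upair (vertex_of M c) (vertex_of M (rev M c)) = Upair y z"
        by (auto simp: edges_graph_of)
      then have "c \<in> T \<or> rev M c \<in> T" using step.IH vertex_of_self by auto
      then have "c \<in> T" "rev M c \<in> T" using T(4) rev_rev[of c] by (metis image_subset_iff)+
      then show ?case using orb c(2) by auto
    qed
    then show ?thesis using vertex_of_self by blast
  qed
  then show "T = darts M" using T(1) by blast
next
  assume con: "\<forall>T. T \<subseteq> darts M \<longrightarrow> T \<noteq> {} \<longrightarrow> rot M ` T \<subseteq> T \<longrightarrow> rev M ` T \<subseteq> T \<longrightarrow> T = darts M"
  show "connected_graph (graph_of M)"
  proof (cases "darts M = {}")
    case True
    then show ?thesis by (simp add: connected_graph_def graph_of_def cells_def reachable_refl)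
  next
    case nonempty: False
    have "(vertex_of M c, vertex_of M d) \<in> reachable (graph_of M)"
      if "c \<in> darts M" "d \<in> darts M" for c d
    proof -
      let ?T = "{d \<in> darts M. (vertex_of M c, vertex_of M d) \<in> reachable (graph_of M)}"
      have "(vertex_of M d, vertex_of M (rev M d)) \<in> reachable (graph_of M)" if "d \<in> darts M" for d
        by (rule reachable_edge[of "edge_of M d"]) (simp_all add: edges_graph_of that)
      then have "rev M ` ?T \<subseteq> ?T" using reachable_trans by fastforce
      moreover have "rot M ` ?T \<subseteq> ?T" by auto
      moreover have "c \<in> ?T" using that by (simp add: reachable_refl)
      ultimately have "?T = darts M" using con by blast
      then show ?thesis using that by blast
    qed
    then show ?thesis
      using nonempty by (auto simp: connected_graph_def verts_graph_of)
  qed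
qed

end

section \<open>Even edge sets bound in the sphere\<close>

text \<open>
  The first homology of the sphere with coefficients in the field with two elements vanishes:
  an edge set with an even number of half-edges at every vertex is the boundary of a set of
  faces, whose indicator is the 2-colouring \<open>P\<close>.  Boundaries of face sets are even, so it
  suffices that there are at least as many of them as even edge sets.  With \<open>v\<close>, \<open>e\<close>, \<open>f\<close> the
  numbers of vertices, edges and faces, only the empty and the full face set have empty
  boundary, so there are \<open>2 ^ (f - 1)\<close> boundaries.  Since paths join any vertex to a fixed one,
  every set of the other vertices is the set of odd vertices of some edge set, up to the fixed
  vertex; so there are at least \<open>2 ^ (v - 1)\<close> sets of odd vertices, and at most \<open>2 ^ (e - v + 1)\<close> edge sets are even.  By Euler's formula
  the exponents agree.
\<close>
theorem even_edge_set_bounds: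
  assumes plane: "plane_graph M"
    and sym: "\<And>d. d \<in> darts M \<Longrightarrow> w (rev M d) \<longleftrightarrow> w d"
    and even: "\<And>d. d \<in> darts M \<Longrightarrow> even (card {c \<in> vertex_of M d. w c})"
  shows "\<exists>P :: 'd \<Rightarrow> bool. (\<forall>d\<in>darts M. P (inv (rot M) (rev M d)) = P d) \<and>
    (\<forall>d\<in>darts M. w d \<longleftrightarrow> P d \<noteq> P (rev M d))"
proof (cases "darts M = {}")
  case nonempty: False
  interpret combinatorial_map M using plane plane_graph_iff by blast
  have con: "T = darts M"
    if "T \<subseteq> darts M" "T \<noteq> {}" "rot M ` T \<subseteq> T" "rev M ` T \<subseteq> T" for T
    using plane that connected_iff unfolding plane_graph_iff by blast
  define V E F where "V = vertex_of M ` darts M" and "E = edge_of M ` darts M"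
    and "F = face_of M ` darts M"
  have fin: "finite V" "finite E" "finite F" by (simp_all add: V_def E_def F_def)
  have euler: "int (card V) - int (card E) + int (card F) = 2"
    using plane nonempty
    by (simp add: plane_graph_iff verts_graph_of edges_graph_of faces_eq V_def E_def F_def)
  have in_V: "d \<in> v \<longleftrightarrow> vertex_of M d = v" if "v \<in> V" for v d
    using that vertex_of_eq_iff unfolding V_def by blast
  have fin_V: "finite v" if "v \<in> V" for v
    using that finite_vertex_of unfolding V_def by blast
  define odd_verts where "odd_verts X = {v \<in> V. odd (card {d \<in> v. edge_of M d \<in> X})}" for X
  define boundary where
    "boundary S = {e \<in> E. \<exists>d\<in>darts M. e = edge_of M d \<and> face_of M d \<in> S \<and> face_of M (rev M d) \<notin> S}"
    for S
  have boundary_iff: "edge_of M d \<in> boundary S \<longleftrightarrow> (face_of M d \<in> S) \<noteq> (face_of M (rev M d) \<in> S)"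
    if "d \<in> darts M" for d S
    using that unfolding boundary_def E_def
    by (auto simp: edge_of_eq_iff intro: bexI[of _ d] bexI[of _ "rev M d"])
  have odd_verts_diff: "odd_verts (sym_diff X Y) = sym_diff (odd_verts X) (odd_verts Y)" for X Y
  proof -
    have "odd (card {d \<in> v. edge_of M d \<in> sym_diff X Y}) \<longleftrightarrow>
        odd (card {d \<in> v. edge_of M d \<in> X}) \<noteq> odd (card {d \<in> v. edge_of M d \<in> Y})" if "v \<in> V" for v
    proof -
      have "{d \<in> v. edge_of M d \<in> sym_diff X Y} =
          sym_diff {d \<in> v. edge_of M d \<in> X} {d \<in> v. edge_of M d \<in> Y}" by auto
      then show ?thesis
        using odd_card_sym_diff[of "{d \<in> v. edge_of M d \<in> X}" "{d \<in> v. edge_of M d \<in> Y}"]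
          fin_V[OF that] by simp
    qed
    then show ?thesis unfolding odd_verts_def by blast
  qed
  have boundary_diff: "boundary (sym_diff S T) = sym_diff (boundary S) (boundary T)" for S T
  proof -
    have "e \<in> boundary (sym_diff S T) \<longleftrightarrow> e \<in> sym_diff (boundary S) (boundary T)" if e: "e \<in> E" for e
    proof -
      obtain d where "d \<in> darts M" "e = edge_of M d" using e unfolding E_def by blast
      then show ?thesis using boundary_iff[of d] by simp blast
    qed
    moreover have "boundary X \<subseteq> E" for X unfolding boundary_def by blast
    ultimately show ?thesis by blast
  qed
  have boundary_even: "boundary ` Pow F \<subseteq> {X \<in> Pow E. odd_verts X = {}}"
  proof -
    have "odd_verts (boundary S) = {}" for S
    proof -
      have "even (card {c \<in> vertex_of M d. edge_of M c \<in> boundary S})" if d: "d \<in> darts M" for d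
      proof -
        have "edge_of M c \<in> boundary S \<longleftrightarrow> (face_of M c \<in> S) \<noteq> (face_of M (inv (rot M) c) \<in> S)"
          if "c \<in> vertex_of M d" for c
          using boundary_iff face_of_inv_rot vertex_of_subset[OF d] that by auto
        moreover have "vertex_of M d = orbit (inv (rot M)) d"
        proof -
          have "permutation (rot M)"
            unfolding permutation_permutes using rot_permutes finite_darts by blast
          then show ?thesis unfolding vertex_of_def by (rule orbit_inv_eq[symmetric])
        qed
        ultimately show ?thesis
          using even_changes_on_orbit[OF permutes_inv[OF rot_permutes] finite_darts d, of "\<lambda>c. face_of M c \<in> S"]
          by (simp cong: conj_cong)
      qed
      then show ?thesis unfolding odd_verts_def V_def by blast
    qed
    then show ?thesis unfolding boundary_def by blast
  qed
  have "2 ^ card F \<le> card (boundary ` Pow F) * 2"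
  proof -
    have "{S \<in> Pow F. boundary S = {}} \<subseteq> {{}, F}"
    proof
      fix S assume S: "S \<in> {S \<in> Pow F. boundary S = {}}"
      define T where "T = {d \<in> darts M. face_of M d \<in> S}"
      have rv: "rev M ` T \<subseteq> T"
      proof (rule image_subsetI)
        fix d assume "d \<in> T"
        then show "rev M d \<in> T" using S boundary_iff[of d S] by (simp add: T_def)
      qed
      have rt: "rot M ` T \<subseteq> T"
      proof (rule image_subsetI)
        fix d assume d: "d \<in> T"
        have "face_of M (rev M (rot M d)) = face_of M d"
          using face_of_inv_rot[of "rot M d"] by simp
        then have "rev M (rot M d) \<in> T" using d by (simp add: T_def)
        then show "rot M d \<in> T" using rv rev_rev[of "rot M d"] by (metis image_subset_iff)
      qed
      have "T \<subseteq> darts M" by (auto simp: T_def)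
      then have "T = {} \<or> T = darts M" using con[OF _ _ rt rv] by blast
      then show "S \<in> {{}, F}" using S unfolding T_def F_def by blast
    qed
    then have "card {S \<in> Pow F. boundary S = {}} \<le> card {{}, F}" by (rule card_mono[rotated]) simp
    also have "\<dots> \<le> 2" by (simp add: card_insert_if)
    finally have "card (boundary ` Pow F) * card {S \<in> Pow F. boundary S = {}} \<le> card (boundary ` Pow F) * 2"
      by (rule mult_le_mono2)
    also have "card (boundary ` Pow F) * card {S \<in> Pow F. boundary S = {}} = 2 ^ card F"
      by (rule card_image_mult_card_kernel[OF fin(3) boundary_diff])
    finally show ?thesis .
  qed
  moreover have "2 ^ card V \<le> card (odd_verts ` Pow E) * 2"
  proof -
    obtain d0 where d0: "d0 \<in> darts M" using nonempty by blast
    define v0 where "v0 = vertex_of M d0"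
    define I where "I = odd_verts ` Pow E"
    have I_diff: "sym_diff X Y \<in> I" if XY: "X \<in> I" "Y \<in> I" for X Y
    proof -
      obtain X' Y' where "X' \<subseteq> E" "Y' \<subseteq> E" "X = odd_verts X'" "Y = odd_verts Y'"
        using XY unfolding I_def by blast
      then show ?thesis
        using odd_verts_diff[of X' Y'] unfolding I_def by (intro image_eqI[of _ _ "sym_diff X' Y'"]) auto
    qed
    have I_empty: "{} \<in> I" unfolding I_def odd_verts_def by (auto intro!: image_eqI[of _ _ "{}"])
    have I_edge: "sym_diff {vertex_of M d} {vertex_of M (rev M d)} \<in> I" if d: "d \<in> darts M" for d
    proof -
      have "odd (card {c \<in> v. edge_of M c \<in> {edge_of M d}}) \<longleftrightarrow> (d \<in> v) \<noteq> (rev M d \<in> v)" for v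
      proof -
        have "{c \<in> v. edge_of M c \<in> {edge_of M d}} = v \<inter> {d, rev M d}"
          by (auto simp: edge_of_eq_iff)
        then show ?thesis using rev_neq[OF d] by (auto simp: Int_insert_right)
      qed
      then have "odd_verts {edge_of M d} = {v \<in> V. (d \<in> v) \<noteq> (rev M d \<in> v)}"
        unfolding odd_verts_def by simp
      also have "\<dots> = sym_diff {vertex_of M d} {vertex_of M (rev M d)}"
        using in_V d by (auto simp: V_def)
      finally show ?thesis using d unfolding I_def E_def by (intro image_eqI[of _ _ "{edge_of M d}"]) auto
    qed
    have I_pair: "sym_diff {v} {v0} \<in> I" if v: "v \<in> V" for v
    proof -
      define T where "T = {d \<in> darts M. sym_diff {vertex_of M d} {v0} \<in> I}"
      have "rev M ` T \<subseteq> T"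
      proof (rule image_subsetI)
        fix d assume d: "d \<in> T"
        have "sym_diff (sym_diff {vertex_of M d} {vertex_of M (rev M d)}) (sym_diff {vertex_of M d} {v0}) \<in> I"
          using d unfolding T_def by (intro I_diff[OF I_edge]) simp_all
        also have "sym_diff (sym_diff {vertex_of M d} {vertex_of M (rev M d)}) (sym_diff {vertex_of M d} {v0})
            = sym_diff {vertex_of M (rev M d)} {v0}" by blast
        finally show "rev M d \<in> T" using d by (simp add: T_def)
      qed
      moreover have "rot M ` T \<subseteq> T" by (auto simp: T_def)
      moreover have "d0 \<in> T" using d0 I_empty by (simp add: T_def v0_def)
      moreover have "T \<subseteq> darts M" by (auto simp: T_def)
      ultimately have "T = darts M" using con[of T] by blast
      then show ?thesis using v unfolding T_def V_def by blast
    qed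
    \<comment> \<open>Add up paths from \<open>v0\<close>; only the parity at \<open>v0\<close> itself is not under control.\<close>
    have "Pow (V - {v0}) \<subseteq> (\<lambda>X. X - {v0}) ` I"
    proof
      fix X assume "X \<in> Pow (V - {v0})"
      then have "finite X" "X \<subseteq> V - {v0}" using fin(1) finite_subset by auto
      then show "X \<in> (\<lambda>X. X - {v0}) ` I"
      proof (induction X rule: finite_induct)
        case empty
        show ?case using I_empty by (auto intro: image_eqI[of _ _ "{}"])
      next
        case (insert v X)
        then obtain Y where Y: "Y \<in> I" "X = Y - {v0}" by blast
        have "sym_diff (sym_diff {v} {v0}) Y \<in> I" using insert.prems Y(1) by (intro I_diff I_pair) auto
        moreover have "insert v X = sym_diff (sym_diff {v} {v0}) Y - {v0}"
          using Y insert.hyps insert.prems by auto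
        ultimately show ?case by blast
      qed
    qed
    then have "card (Pow (V - {v0})) \<le> card I"
      using fin(2) by (intro surj_card_le) (simp_all add: I_def)
    moreover have "card V = Suc (card (V - {v0}))"
      using d0 fin(1) by (intro card.remove) (simp_all add: v0_def V_def)
    ultimately show ?thesis using fin(1) by (simp add: card_Pow I_def)
  qed
  ultimately have "card {X \<in> Pow E. odd_verts X = {}} \<le> card (boundary ` Pow F)"
  proof -
    let ?k = "card {X \<in> Pow E. odd_verts X = {}}" and ?i = "card (boundary ` Pow F)"
    assume f: "2 ^ card F \<le> ?i * 2" and v: "2 ^ card V \<le> card (odd_verts ` Pow E) * 2"
    have "2 ^ card V * ?k \<le> card (odd_verts ` Pow E) * 2 * ?k" using v by (rule mult_le_mono1)
    also have "\<dots> = 2 * 2 ^ card E"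
      using card_image_mult_card_kernel[OF fin(2), of odd_verts] odd_verts_diff by simp
    finally have "2 ^ card V * ?k * 2 \<le> 2 ^ (card E + 2)" by simp
    also have "card E + 2 = card V + card F" using euler by linarith
    also have "(2::nat) ^ (card V + card F) \<le> 2 ^ card V * (?i * 2)"
      using f by (simp add: power_add)
    finally show ?thesis by simp
  qed
  then have eq: "boundary ` Pow F = {X \<in> Pow E. odd_verts X = {}}"
    using boundary_even fin(2) by (intro card_seteq) simp_all
  define W where "W = edge_of M ` {d \<in> darts M. w d}"
  have W_iff: "edge_of M d \<in> W \<longleftrightarrow> w d" if "d \<in> darts M" for d
    using that sym by (auto simp: W_def edge_of_eq_iff)
  have "odd_verts W = {}"
  proof -
    have "{c \<in> vertex_of M d. edge_of M c \<in> W} = {c \<in> vertex_of M d. w c}" if "d \<in> darts M" for d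
      using W_iff vertex_of_subset[OF that] by blast
    then have "even (card {c \<in> vertex_of M d. edge_of M c \<in> W})" if "d \<in> darts M" for d
      using even[OF that] that by simp
    then show ?thesis unfolding odd_verts_def V_def by blast
  qed
  then have "W \<in> boundary ` Pow F" unfolding eq by (auto simp: W_def E_def)
  then obtain S where S: "W = boundary S" by blast
  show ?thesis
  proof (intro exI[of _ "\<lambda>d. face_of M d \<in> S"] conjI ballI)
    fix d assume "d \<in> darts M"
    then show "w d \<longleftrightarrow> (face_of M d \<in> S) \<noteq> (face_of M (rev M d) \<in> S)"
      using W_iff boundary_iff S by blast
  qed simp
qed simp

section \<open>Eulerian components of \<open>\<Phi>\<close> and colourings of its regions\<close>

context combinatorial_map
begin

text \<open>Half-edges at a vertex: a loop is counted once for each of its two darts.\<close>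
lemma card_half_edges:
  assumes W: "W \<subseteq> edges (graph_of M)" and v: "v \<in> verts (graph_of M)"
  shows "card {e \<in> W. v \<in> set_uprod (ends (graph_of M) e)} + card {e \<in> W. ends (graph_of M) e = Upair v v}
    = card {d \<in> v. edge_of M d \<in> W}"
proof (cases "darts M = {}")
  case True
  then have "W = {}" using W by (simp add: edges_graph_of)
  then show ?thesis by simp
next
  case nonempty: False
  obtain d0 where d0: "d0 \<in> darts M" "v = vertex_of M d0"
    using v by (auto simp: verts_graph_of[OF nonempty])
  have in_v: "d \<in> v \<longleftrightarrow> vertex_of M d = v" for d using vertex_of_eq_iff d0(2) by blast
  have fin_v: "finite v" using finite_vertex_of d0 by simp
  have fin_W: "finite W" using W by (rule finite_subset) (simp add: edges_graph_of)
  have "card {d \<in> v. edge_of M d \<in> W} = (\<Sum>e\<in>W. card {d \<in> v. edge_of M d = e})"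
  proof -
    have "{d \<in> {d \<in> v. edge_of M d \<in> W}. edge_of M d = e} = {d \<in> v. edge_of M d = e}" if "e \<in> W" for e
      using that by blast
    then have "(\<Sum>e\<in>W. card {d \<in> v. edge_of M d = e}) =
        (\<Sum>e\<in>W. \<Sum>d | d \<in> {d \<in> v. edge_of M d \<in> W} \<and> edge_of M d = e. 1)"
      by (intro sum.cong) simp_all
    also have "\<dots> = (\<Sum>d\<in>{d \<in> v. edge_of M d \<in> W}. 1)"
      by (rule sum.group) (use fin_v fin_W in auto)
    finally show ?thesis by simp
  qed
  also have "\<dots> = (\<Sum>e\<in>W. of_bool (v \<in> set_uprod (ends (graph_of M) e)) +
      of_bool (ends (graph_of M) e = Upair v v))"
  proof (rule sum.cong[OF refl])
    fix e assume "e \<in> W"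
    then obtain c where c: "c \<in> darts M" "e = edge_of M c" using W by (auto simp: edges_graph_of)
    have "{d \<in> v. edge_of M d = e} = v \<inter> {c, rev M c}" by (auto simp: c(2) edge_of_eq_iff)
    moreover have "card (v \<inter> {c, rev M c}) = of_bool (c \<in> v) + of_bool (rev M c \<in> v)"
      using rev_neq[OF c(1)] by (simp add: Int_insert_right)
    ultimately show "card {d \<in> v. edge_of M d = e} = of_bool (v \<in> set_uprod (ends (graph_of M) e)) +
        of_bool (ends (graph_of M) e = Upair v v)"
      by (auto simp: c(2) in_v)
  qed
  also have "\<dots> = card {e \<in> W. v \<in> set_uprod (ends (graph_of M) e)} +
      card {e \<in> W. ends (graph_of M) e = Upair v v}"
    using fin_W by (simp add: sum.distrib sum_of_bool_eq Int_def)
  finally show ?thesis by simp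
qed

lemma edge_of_dual [simp]: "edge_of (dual M) = edge_of M"
  by (simp add: edge_of_def fun_eq_iff)

lemma edges_Phi:
  assumes "A \<subseteq> edges (graph_of M)"
  shows "edges (Phi M A) = Inl ` A \<union> Inr ` (edges (graph_of M) - A)"
  using assms
  by (auto simp: Phi_def delete_edges_def disjoint_union_def edges_graph_of
      combinatorial_map.edges_graph_of[OF combinatorial_map_dual])

lemma verts_Phi: "verts (Phi M A) = verts (graph_of M) <+> verts (graph_of (dual M))"
  by (simp add: Phi_def delete_edges_def disjoint_union_def)

lemma ends_Phi:
  "ends (Phi M A) (Inl e) = map_uprod Inl (ends (graph_of M) e)"
  "ends (Phi M A) (Inr e) = map_uprod Inr (ends (graph_of (dual M)) e)"
  by (simp_all add: Phi_def delete_edges_def disjoint_union_def)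

lemma graph_Phi:
  assumes "A \<subseteq> edges (graph_of M)"
  shows "graph (Phi M A)"
proof -
  have "edges (graph_of (dual M)) = edges (graph_of M)" by (simp add: graph_of_def)
  then show ?thesis
    using assms graph_graph_of combinatorial_map.graph_graph_of[OF combinatorial_map_dual]
    unfolding graph_def by (fastforce simp: edges_Phi[OF assms] verts_Phi ends_Phi uprod.set_map)
qed

lemma degree_Phi_vertex:
  assumes A: "A \<subseteq> edges (graph_of M)" and v: "v \<in> verts (graph_of M)"
  shows "degree (Phi M A) (Inl v) = card {d \<in> v. edge_of M d \<in> A}"
proof -
  have inj: "map_uprod Inl u = Upair (Inl v) (Inl v) \<longleftrightarrow> u = Upair v v" for u :: "'d set uprod"
    by (cases u) simp
  have "{e \<in> edges (Phi M A). Inl v \<in> set_uprod (ends (Phi M A) e)} =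
      Inl ` {e \<in> A. v \<in> set_uprod (ends (graph_of M) e)}"
    by (auto simp: edges_Phi[OF A] ends_Phi uprod.set_map)
  moreover have "{e \<in> edges (Phi M A). ends (Phi M A) e = Upair (Inl v) (Inl v)} =
      Inl ` {e \<in> A. ends (graph_of M) e = Upair v v}"
  proof -
    have "map_uprod Inr u \<noteq> Upair (Inl v) (Inl v)" for u :: "'d set uprod" by (cases u) simp
    then show ?thesis by (auto simp: edges_Phi[OF A] ends_Phi inj)
  qed
  ultimately show ?thesis
    using card_half_edges[OF A v] by (simp add: degree_def card_image)
qed

lemma degree_Phi_face:
  assumes A: "A \<subseteq> edges (graph_of M)" and f: "f \<in> verts (graph_of (dual M))"
  shows "degree (Phi M A) (Inr f) = card {d \<in> f. edge_of M d \<in> edges (graph_of M) - A}"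
proof -
  interpret d: combinatorial_map "dual M" by (rule combinatorial_map_dual)
  have E: "edges (graph_of (dual M)) = edges (graph_of M)" by (simp add: graph_of_def)
  have inj: "map_uprod Inr u = Upair (Inr f) (Inr f) \<longleftrightarrow> u = Upair f f" for u :: "'d set uprod"
    by (cases u) simp
  have "{e \<in> edges (Phi M A). Inr f \<in> set_uprod (ends (Phi M A) e)} =
      Inr ` {e \<in> edges (graph_of M) - A. f \<in> set_uprod (ends (graph_of (dual M)) e)}"
    by (auto simp: edges_Phi[OF A] ends_Phi uprod.set_map)
  moreover have "{e \<in> edges (Phi M A). ends (Phi M A) e = Upair (Inr f) (Inr f)} =
      Inr ` {e \<in> edges (graph_of M) - A. ends (graph_of (dual M)) e = Upair f f}"
  proof -
    have "map_uprod Inl u \<noteq> Upair (Inr f) (Inr f)" for u :: "'d set uprod" by (cases u) simp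
    then show ?thesis by (auto simp: edges_Phi[OF A] ends_Phi inj)
  qed
  ultimately show ?thesis
    using d.card_half_edges[OF _ f, of "edges (graph_of M) - A"] E
    by (simp add: degree_def card_image)
qed

lemma Phi_eulerian_iff_even:
  assumes A: "A \<subseteq> edges (graph_of M)"
  shows "(\<forall>C\<in>components (Phi M A). eulerian C) \<longleftrightarrow>
    (\<forall>d\<in>darts M. even (card {c \<in> vertex_of M d. edge_of M c \<in> A}) \<and>
      even (card {c \<in> face_of M d. edge_of M c \<notin> A}))"
proof (cases "darts M = {}")
  case True
  then have "edges (graph_of M) = {}" by (simp add: edges_graph_of)
  then have "edges (Phi M A) = {}" using A edges_Phi[OF A] by simp
  then show ?thesis using True components_eulerian_iff[OF graph_Phi[OF A]] by (simp add: degree_def)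
next
  case nonempty: False
  interpret d: combinatorial_map "dual M" by (rule combinatorial_map_dual)
  have V: "verts (graph_of M) = vertex_of M ` darts M" "verts (graph_of (dual M)) = face_of M ` darts M"
    using nonempty verts_graph_of d.verts_graph_of by (auto simp: face_of_def)
  have "{c \<in> face_of M d. edge_of M c \<in> edges (graph_of M) - A} = {c \<in> face_of M d. edge_of M c \<notin> A}"
    if "d \<in> darts M" for d
    using face_of_subset[OF that] by (auto simp: edges_graph_of)
  then have "even (degree (Phi M A) (Inl (vertex_of M d))) \<longleftrightarrow>
        even (card {c \<in> vertex_of M d. edge_of M c \<in> A})"
      "even (degree (Phi M A) (Inr (face_of M d))) \<longleftrightarrow>
        even (card {c \<in> face_of M d. edge_of M c \<notin> A})" if "d \<in> darts M" for d
    using degree_Phi_vertex[OF A] degree_Phi_face[OF A] that by (simp_all add: V)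
  moreover have "(\<forall>v\<in>verts (Phi M A). even (degree (Phi M A) v)) \<longleftrightarrow>
      (\<forall>d\<in>darts M. even (degree (Phi M A) (Inl (vertex_of M d))) \<and>
        even (degree (Phi M A) (Inr (face_of M d))))"
    by (auto simp: verts_Phi V)
  ultimately show ?thesis
    unfolding components_eulerian_iff[OF graph_Phi[OF A]] by simp
qed

lemma permutation_rot: "permutation (rot M)"
  unfolding permutation_permutes using rot_permutes finite_darts by blast

lemma orbit_inv_rot: "orbit (inv (rot M)) d = vertex_of M d"
  unfolding vertex_of_def by (rule orbit_inv_eq[OF permutation_rot])

text \<open>
  The predicate \<open>z\<close> 2-colours the quadrangles of the standard immersion so that the colour
  changes exactly across the edges of \<open>\<Phi>\<close>.  At the quadrangles of \<open>d\<close> and \<open>rev M d\<close> this means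
  that the colours differ, because they are opposite at a crossing and exactly one of the two edges
  that cross there belongs to \<open>\<Phi>\<close>.  Around a vertex or the centre of a face the colour changes
  once for each half-edge of \<open>\<Phi>\<close>, hence evenly often.
\<close>
lemma Phi_eulerian_if_colouring:
  assumes A: "A \<subseteq> edges (graph_of M)"
    and rv: "\<And>d. d \<in> darts M \<Longrightarrow> z (rev M d) \<longleftrightarrow> \<not> z d"
    and rt: "\<And>d. d \<in> darts M \<Longrightarrow> edge_of M d \<in> A \<longleftrightarrow> z d \<noteq> z (inv (rot M) d)"
  shows "\<forall>C\<in>components (Phi M A). eulerian C"
  unfolding Phi_eulerian_iff_even[OF A]
proof (intro ballI conjI)
  fix d assume d: "d \<in> darts M"
  interpret d: combinatorial_map "dual M" by (rule combinatorial_map_dual)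
  have "{c \<in> vertex_of M d. edge_of M c \<in> A} = {c \<in> orbit (inv (rot M)) d. z c \<noteq> z (inv (rot M) c)}"
    using rt vertex_of_subset[OF d] by (auto simp: orbit_inv_rot)
  then show "even (card {c \<in> vertex_of M d. edge_of M c \<in> A})"
    using even_changes_on_orbit[OF permutes_inv[OF rot_permutes] finite_darts d, of z] by simp
  have "edge_of M c \<notin> A \<longleftrightarrow> z c \<noteq> z (rot (dual M) c)" if "c \<in> darts M" for c
    using rt[of "rev M c"] rv that by auto
  then have "{c \<in> face_of M d. edge_of M c \<notin> A} = {c \<in> orbit (rot (dual M)) d. z c \<noteq> z (rot (dual M) c)}"
    using face_of_subset[OF d] unfolding face_of_def vertex_of_def by blast
  then show "even (card {c \<in> face_of M d. edge_of M c \<notin> A})"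
    using even_changes_on_orbit[OF d.rot_permutes d.finite_darts, of d z] d by simp
qed

end

text \<open>
  Conversely, \<open>\<Phi>\<close> is an even subgraph of the sphere, so its regions have a 2-colouring.  Inside
  each face of the map the colours can be chosen, up to a global swap, because evenly many
  half-edges of \<open>\<Phi>\<close> end at the centre of the face; this is \<open>z0\<close>.  The edges across which the
  choices of the two adjacent faces disagree with what is wanted form an even edge set, so a
  suitable set of faces can be swapped to repair all of them at once.
\<close>
lemma colouring_if_Phi_eulerian:
  assumes plane: "plane_graph M" and A: "A \<subseteq> edges (graph_of M)"
    and euler: "\<forall>C\<in>components (Phi M A). eulerian C"
  obtains z :: "'d \<Rightarrow> bool" where
    "\<And>d. d \<in> darts M \<Longrightarrow> z (rev M d) \<longleftrightarrow> \<not> z d"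
    "\<And>d. d \<in> darts M \<Longrightarrow> edge_of M d \<in> A \<longleftrightarrow> z d \<noteq> z (inv (rot M) d)"
proof -
  interpret combinatorial_map M using plane plane_graph_iff by blast
  interpret d: combinatorial_map "dual M" by (rule combinatorial_map_dual)
  have even_v: "even (card {c \<in> vertex_of M d. edge_of M c \<in> A})"
    and even_f: "even (card {c \<in> face_of M d. edge_of M c \<notin> A})" if "d \<in> darts M" for d
    using euler that Phi_eulerian_iff_even[OF A] by blast+
  obtain z0 :: "'d \<Rightarrow> bool" where "\<forall>d\<in>darts M. edge_of M d \<notin> A \<longleftrightarrow> z0 d \<noteq> z0 (rot (dual M) d)"
    using exists_changes_on_orbits[OF d.rot_permutes d.finite_darts, of "\<lambda>d. edge_of M d \<notin> A"] even_f
    unfolding face_of_def vertex_of_def by auto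
  then have z0: "edge_of M d \<notin> A \<longleftrightarrow> z0 d \<noteq> z0 (inv (rot M) (rev M d))" if "d \<in> darts M" for d
    using that by simp
  have z0': "edge_of M d \<notin> A \<longleftrightarrow> z0 (rev M d) \<noteq> z0 (inv (rot M) d)" if "d \<in> darts M" for d
    using z0[of "rev M d"] that by simp
  have "even (card {c \<in> vertex_of M d. z0 c = z0 (rev M c)})" if d: "d \<in> darts M" for d
  proof -
    let ?X = "{c \<in> vertex_of M d. z0 c \<noteq> z0 (inv (rot M) c)}"
    let ?Y = "{c \<in> vertex_of M d. edge_of M c \<in> A}"
    have "even (card ?X)"
      using even_changes_on_orbit[OF permutes_inv[OF rot_permutes] finite_darts d, of z0]
      by (simp add: orbit_inv_rot)
    moreover have "{c \<in> vertex_of M d. z0 c = z0 (rev M c)} = sym_diff ?X ?Y"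
      using z0' vertex_of_subset[OF d] by auto
    ultimately show ?thesis
      using odd_card_sym_diff[of ?X ?Y] finite_vertex_of[OF d] even_v[OF d] by simp
  qed
  then obtain z1 :: "'d \<Rightarrow> bool" where z1: "\<forall>d\<in>darts M. z1 (inv (rot M) (rev M d)) = z1 d"
      "\<forall>d\<in>darts M. z0 d = z0 (rev M d) \<longleftrightarrow> z1 d \<noteq> z1 (rev M d)"
    using even_edge_set_bounds[OF plane, of "\<lambda>d. z0 d = z0 (rev M d)"] by auto
  show ?thesis
  proof
    fix d assume d: "d \<in> darts M"
    have swap: "(z0 (rev M d) \<noteq> z1 (rev M d)) \<longleftrightarrow> \<not> (z0 d \<noteq> z1 d)" using z1(2) d by blast
    then show "(z0 (rev M d) \<noteq> z1 (rev M d)) \<longleftrightarrow> \<not> (z0 d \<noteq> z1 d)" .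
    have "z1 (inv (rot M) d) = z1 (rev M d)" using z1(1)[rule_format, of "rev M d"] d by simp
    then show "edge_of M d \<in> A \<longleftrightarrow> (z0 d \<noteq> z1 d) \<noteq> (z0 (inv (rot M) d) \<noteq> z1 (inv (rot M) d))"
      using z0'[OF d] swap by blast
  qed
qed

section \<open>Medial graphs\<close>

text \<open>
  \<open>D\<close> is the medial graph of \<open>H\<close>, with a crossing at the midpoint of each edge and a diagram edge in
  each quadrangle.  The darts at the crossing of the edge of \<open>d\<close> are, counterclockwise, \<open>w d\<close>,
  \<open>b d\<close>, \<open>w (rev H d)\<close> and \<open>b (rev H d)\<close>.  The dart \<open>b d\<close> has the (black) region of the vertex of \<open>d\<close> on
  its left, and \<open>w d\<close> the (white) region of the face on the left of \<open>d\<close>.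
\<close>
locale medial = H: combinatorial_map H + D: combinatorial_map D
  for H :: "('h, 'm) plane_map_scheme" and D :: "('c, 'n) plane_map_scheme" +
  fixes b w :: "'h \<Rightarrow> 'c"
  assumes inj_b: "inj_on b (darts H)" and inj_w: "inj_on w (darts H)"
    and b_neq_w: "b ` darts H \<inter> w ` darts H = {}"
    and darts_D: "darts D = b ` darts H \<union> w ` darts H"
    and rot_b: "\<And>d. d \<in> darts H \<Longrightarrow> rot D (b d) = w (rev H d)"
    and rot_w: "\<And>d. d \<in> darts H \<Longrightarrow> rot D (w d) = b d"
    and rev_w: "\<And>d. d \<in> darts H \<Longrightarrow> rev D (w d) = b (inv (rot H) (rev H d))"
begin

lemma b_in_darts [simp]: "d \<in> darts H \<Longrightarrow> b d \<in> darts D"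
  and w_in_darts [simp]: "d \<in> darts H \<Longrightarrow> w d \<in> darts D"
  by (auto simp: darts_D)

lemma b_eq_iff [simp]: "c \<in> darts H \<Longrightarrow> d \<in> darts H \<Longrightarrow> b c = b d \<longleftrightarrow> c = d"
  and w_eq_iff [simp]: "c \<in> darts H \<Longrightarrow> d \<in> darts H \<Longrightarrow> w c = w d \<longleftrightarrow> c = d"
  and b_w_neq [simp]: "c \<in> darts H \<Longrightarrow> d \<in> darts H \<Longrightarrow> b c \<noteq> w d"
    "c \<in> darts H \<Longrightarrow> d \<in> darts H \<Longrightarrow> w d \<noteq> b c"
  using inj_b inj_w b_neq_w by (auto dest: inj_onD)

lemma rev_b: "d \<in> darts H \<Longrightarrow> rev D (b d) = w (rev H (rot H d))"
  using rev_w[of "rev H (rot H d)"] D.rev_rev[of "w (rev H (rot H d))"] by simp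

lemma inv_rot_b: "d \<in> darts H \<Longrightarrow> inv (rot D) (b d) = w d"
  using rot_w[of d] D.rot_inv_rot(2)[of "w d"] by simp

lemma inv_rot_w: "d \<in> darts H \<Longrightarrow> inv (rot D) (w d) = b (rev H d)"
  using rot_b[of "rev H d"] D.rot_inv_rot(2)[of "b (rev H d)"] by simp

lemma vertex_of_b: "d \<in> darts H \<Longrightarrow> vertex_of D (b d) = {b d, w (rev H d), b (rev H d), w d}"
proof -
  assume d: "d \<in> darts H"
  have "(rot D ^^ 4) (b d) = b d"
    using d by (simp add: numeral_eq_Suc rot_b rot_w)
  then have "vertex_of D (b d) = {(rot D ^^ m) (b d) | m. m < 4}"
    unfolding vertex_of_def by (rule orbit_altdef_bounded) simp
  also have "\<dots> = {b d, rot D (b d), rot D (rot D (b d)), rot D (rot D (rot D (b d)))}"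
  proof -
    have "{m. m < 4} = {0, 1, 2, 3 :: nat}" by auto
    then have "{(rot D ^^ m) (b d) | m. m < 4} = (\<lambda>m. (rot D ^^ m) (b d)) ` {0, 1, 2, 3}"
      by (simp only: setcompr_eq_image)
    then show ?thesis by (simp add: numeral_eq_Suc)
  qed
  finally show ?thesis using d by (simp add: rot_b rot_w)
qed

lemma vertex_of_w: "d \<in> darts H \<Longrightarrow> vertex_of D (w d) = vertex_of D (b d)"
  using D.vertex_of_rot[of "w d"] by (simp add: rot_w)

lemma card_vertex_of: "h \<in> darts D \<Longrightarrow> card (vertex_of D h) = 4"
  by (auto simp: darts_D vertex_of_w vertex_of_b H.rev_neq H.rev_neq[symmetric] card_insert_if)

lemma face_of_b: "d \<in> darts H \<Longrightarrow> face_of D (b d) = b ` vertex_of H d"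
proof -
  assume d: "d \<in> darts H"
  have "b ` orbit (rot H) d = orbit (rot (dual D)) (b d)"
  proof (rule orbit_inverse)
    show "d \<in> orbit (rot H) d" using H.vertex_of_self by (simp add: vertex_of_def)
    fix c assume "c \<in> orbit (rot H) d"
    then have "c \<in> darts H" using H.vertex_of_subset[OF d] by (auto simp: vertex_of_def)
    then show "rot (dual D) (b c) = b (rot H c)" by (simp add: rev_b inv_rot_w)
  qed
  then show ?thesis by (simp add: face_of_def vertex_of_def)
qed

lemma face_of_w: "d \<in> darts H \<Longrightarrow> face_of D (w d) = w ` face_of H d"
proof -
  assume d: "d \<in> darts H"
  have "w ` orbit (rot (dual H)) d = orbit (rot (dual D)) (w d)"
  proof (rule orbit_inverse)
    show "d \<in> orbit (rot (dual H)) d"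
      using H.face_of_self by (simp add: face_of_def vertex_of_def)
    fix c assume "c \<in> orbit (rot (dual H)) d"
    then have "c \<in> darts H" using H.face_of_subset[OF d] by (auto simp: face_of_def vertex_of_def)
    then show "rot (dual D) (w c) = w (rot (dual H) c)" by (simp add: rev_w inv_rot_b)
  qed
  then show ?thesis by (simp add: face_of_def vertex_of_def)
qed

lemma connected_graph_iff: "connected_graph (graph_of D) \<longleftrightarrow> connected_graph (graph_of H)"
  unfolding D.connected_iff H.connected_iff
proof (intro iffI allI impI)
  fix T
  assume con: "\<forall>T. T \<subseteq> darts D \<longrightarrow> T \<noteq> {} \<longrightarrow> rot D ` T \<subseteq> T \<longrightarrow> rev D ` T \<subseteq> T \<longrightarrow> T = darts D"
    and T: "T \<subseteq> darts H" "T \<noteq> {}" "rot H ` T \<subseteq> T" "rev H ` T \<subseteq> T"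
  have inv: "inv (rot H) d \<in> T" if "d \<in> T" for d
    using permutes_closed_inv[OF H.rot_permutes H.finite_darts T(1,3) that] .
  let ?T = "b ` T \<union> w ` T"
  have closed: "d \<in> darts H" "rot H d \<in> T" "rev H d \<in> T" if "d \<in> T" for d
    using that T(1,3,4) by blast+
  have "rot D h \<in> ?T \<and> rev D h \<in> ?T" if "h \<in> ?T" for h
    using that
  proof
    assume "h \<in> b ` T"
    then obtain d where "d \<in> T" "h = b d" by blast
    then show ?thesis using closed(1)[of d] closed(3)[of d] closed(3)[OF closed(2), of d]
      by (simp add: rot_b rev_b)
  next
    assume "h \<in> w ` T"
    then obtain d where "d \<in> T" "h = w d" by blast
    then show ?thesis using closed(1)[of d] inv[OF closed(3), of d]
      by (simp add: rot_w rev_w)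
  qed
  then have "rot D ` ?T \<subseteq> ?T" "rev D ` ?T \<subseteq> ?T" by blast+
  moreover have "?T \<subseteq> darts D" "?T \<noteq> {}" using T(2) closed(1) by (auto simp: darts_D)
  ultimately have "?T = darts D" using con by blast
  then have "b d \<in> ?T" if "d \<in> darts H" for d using that by simp
  then have "d \<in> T" if "d \<in> darts H" for d using that T(1) by fastforce
  then show "T = darts H" using T(1) by blast
next
  fix T
  assume con: "\<forall>T. T \<subseteq> darts H \<longrightarrow> T \<noteq> {} \<longrightarrow> rot H ` T \<subseteq> T \<longrightarrow> rev H ` T \<subseteq> T \<longrightarrow> T = darts H"
    and T: "T \<subseteq> darts D" "T \<noteq> {}" "rot D ` T \<subseteq> T" "rev D ` T \<subseteq> T"
  have inv: "inv (rot D) h \<in> T" if "h \<in> T" for h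
    using permutes_closed_inv[OF D.rot_permutes D.finite_darts T(1,3) that] .
  have rot: "rot D h \<in> T" and rv: "rev D h \<in> T" if "h \<in> T" for h using that T(3,4) by blast+
  let ?T = "{d \<in> darts H. b d \<in> T}"
  have w_iff: "w d \<in> T \<longleftrightarrow> b d \<in> T" if "d \<in> darts H" for d
    using rot[of "w d"] inv[of "b d"] that by (auto simp: rot_w inv_rot_b)
  have rot_T: "rot H ` ?T \<subseteq> ?T"
  proof (rule image_subsetI)
    fix d assume "d \<in> ?T"
    then show "rot H d \<in> ?T" using inv[OF rv, of "b d"] by (simp add: rev_b inv_rot_w)
  qed
  have rev_T: "rev H ` ?T \<subseteq> ?T"
  proof (rule image_subsetI)
    fix d assume "d \<in> ?T"
    then show "rev H d \<in> ?T" using rot[OF rot, of "b d"] by (simp add: rot_b rot_w)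
  qed
  have "?T \<noteq> {}"
  proof -
    obtain h where "h \<in> T" using T(2) by blast
    moreover from this obtain d where "d \<in> darts H" "h = b d \<or> h = w d"
      using T(1) unfolding darts_D by blast
    ultimately show ?thesis using w_iff by blast
  qed
  then have "?T = darts H" by (intro con[rule_format, OF _ _ rot_T rev_T]) auto
  then have "b d \<in> T" if "d \<in> darts H" for d using that by blast
  then show "T = darts D" using T(1) w_iff unfolding darts_D by blast
qed

text \<open>
  The crossings are the edges of \<open>H\<close>, each with four darts, and the faces are the vertices and
  the faces of \<open>H\<close>; so both sides have the same Euler characteristic.
\<close>
lemma plane_graph_medial_iff: "plane_graph D \<longleftrightarrow> plane_graph H"
proof (cases "darts H = {}")
  case True
  then have "darts D = {}" by (simp add: darts_D)
  then show ?thesis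
    unfolding plane_graph_iff using True H.combinatorial_map_axioms D.combinatorial_map_axioms
      connected_graph_iff
    by (simp add: graph_of_def faces_def cells_def)
next
  case nonempty: False
  then have nonempty': "darts D \<noteq> {}" by (simp add: darts_D)
  have "card (darts D) = card (vertex_of D ` darts D) * 4"
  proof (rule card_eq_fibres)
    fix v assume "v \<in> vertex_of D ` darts D"
    then obtain h where h: "h \<in> darts D" "v = vertex_of D h" by blast
    then have "{k \<in> darts D. vertex_of D k = v} = vertex_of D h"
      using D.vertex_of_eq_iff D.vertex_of_subset[OF h(1)] by blast
    then show "card {k \<in> darts D. vertex_of D k = v} = 4" using card_vertex_of[OF h(1)] by simp
  qed simp
  moreover have "card (darts D) = 2 * card (darts H)"
    unfolding darts_D using b_neq_w by (simp add: card_Un_disjoint card_image inj_b inj_w)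
  moreover have "card (darts H) = card (edges (graph_of H)) * 2"
      "card (darts D) = card (edges (graph_of D)) * 2"
    using H.card_darts D.card_darts by (simp_all add: H.edges_graph_of D.edges_graph_of)
  ultimately have V: "card (verts (graph_of D)) = card (edges (graph_of H))"
      and E: "card (edges (graph_of D)) = 2 * card (edges (graph_of H))"
    by (simp_all add: D.verts_graph_of[OF nonempty'])
  have F: "card (faces D) = card (verts (graph_of H)) + card (faces H)"
  proof -
    let ?V = "vertex_of H ` darts H" and ?F = "face_of H ` darts H"
    have "faces D = (`) b ` ?V \<union> (`) w ` ?F"
      unfolding D.faces_eq[OF nonempty']
      by (auto simp: darts_D image_Un image_image face_of_b face_of_w)
    moreover have "(`) b ` ?V \<inter> (`) w ` ?F = {}"
    proof -
      have "b ` v \<noteq> w ` f" if "v \<in> ?V" "f \<in> ?F" for v f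
      proof -
        obtain d where "d \<in> darts H" "v = vertex_of H d" using \<open>v \<in> ?V\<close> by blast
        then have "d \<in> v" "d \<in> darts H" by simp_all
        moreover have "f \<subseteq> darts H" using \<open>f \<in> ?F\<close> H.face_of_subset by auto
        ultimately show ?thesis using b_neq_w by blast
      qed
      then show ?thesis by blast
    qed
    moreover have "inj_on ((`) b) ?V" "inj_on ((`) w) ?F"
      using inj_on_image_eq_iff[OF inj_b] inj_on_image_eq_iff[OF inj_w]
        H.vertex_of_subset H.face_of_subset
      by (auto intro!: inj_onI)
    ultimately show ?thesis
      by (simp add: card_Un_disjoint card_image H.verts_graph_of[OF nonempty] H.faces_eq[OF nonempty])
  qed
  show ?thesis
    unfolding plane_graph_iff V E F
    using connected_graph_iff H.combinatorial_map_axioms D.combinatorial_map_axioms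
    by (simp add: algebra_simps)
qed

end

section \<open>The Seifert graph as \<open>\<Phi>\<^sup>\<circledast>\<close>\<close>

lemma bij_betw_images:
  assumes "\<And>x y. x \<in> S \<Longrightarrow> y \<in> S \<Longrightarrow> u x = u y \<longleftrightarrow> v x = v y"
  obtains g where "bij_betw g (u ` S) (v ` S)" and "\<And>x. x \<in> S \<Longrightarrow> g (u x) = v x"
proof
  let ?g = "\<lambda>y. v (inv_into S u y)"
  show g: "?g (u x) = v x" if "x \<in> S" for x
    using assms[OF inv_into_into[of "u x" u S] that] that by (simp add: f_inv_into_f)
  have "inj_on ?g (u ` S)" using g assms by (auto intro!: inj_onI)
  moreover have "?g ` u ` S = v ` S" using g by (force simp: image_image)
  ultimately show "bij_betw ?g (u ` S) (v ` S)" by (simp add: bij_betw_def)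
qed

lemma sym_closure_Image_eq_iff:
  "(R \<union> R\<inverse>)\<^sup>* `` {x} = (R \<union> R\<inverse>)\<^sup>* `` {y} \<longleftrightarrow> (x, y) \<in> (R \<union> R\<inverse>)\<^sup>*"
proof -
  have "equiv UNIV ((R \<union> R\<inverse>)\<^sup>*)"
    by (intro equivI refl_rtrancl trans_rtrancl sym_rtrancl sym_Un_converse) simp
  then show ?thesis by (simp add: eq_equiv_class_iff)
qed

text \<open>
  The condition \<open>b d \<in> out D\<close> says that the diagram edge in the quadrangle of \<open>d\<close> runs
  counterclockwise around the vertex of \<open>d\<close>; this is the colour of that quadrangle.  The first two
  assumptions on \<open>out D\<close> express that the orientation is consistent along diagram edges and
  through crossings, and the last one says that \<open>A\<close> consists of the edges of \<open>H\<close> across which the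
  colour changes.
\<close>
locale seifert_medial = medial H D b w
  for H :: "'h plane_map" and D :: "'c link_diagram" and b w +
  fixes A :: "'h uprod set"
  assumes A: "A \<subseteq> edges (graph_of H)"
    and out_w: "\<And>d. d \<in> darts H \<Longrightarrow> w d \<in> out D \<longleftrightarrow> b (inv (rot H) (rev H d)) \<notin> out D"
    and out_rev: "\<And>d. d \<in> darts H \<Longrightarrow> b (rev H d) \<in> out D \<longleftrightarrow> b d \<notin> out D"
    and in_A_iff: "\<And>d. d \<in> darts H \<Longrightarrow> edge_of H d \<in> A \<longleftrightarrow> (b d \<in> out D) \<noteq> (b (inv (rot H) d) \<in> out D)"
begin

text \<open>
  The smoothing at the crossing of the edge of \<open>d\<close> joins the darts around the vertex, cutting it
  off, unless the edge belongs to \<open>A\<close>; then it follows the edge on both sides.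
\<close>
lemma smoothing_b: "d \<in> darts H \<Longrightarrow> (b d \<in> out D) \<noteq> (w (rev H d) \<in> out D) \<longleftrightarrow> edge_of H d \<notin> A"
  using in_A_iff[of d] out_w[of "rev H d"] by auto

lemma smoothing_w: "d \<in> darts H \<Longrightarrow> (w d \<in> out D) \<noteq> (b d \<in> out D) \<longleftrightarrow> edge_of H d \<in> A"
  using in_A_iff[of "rev H d"] out_w[of d] out_rev[of d] by auto

lemma seifert_adj_iff:
  "(h, k) \<in> seifert_adj D \<longleftrightarrow> (\<exists>d\<in>darts H.
     h = b d \<and> k = w (rev H (rot H d)) \<or> h = w d \<and> k = b (inv (rot H) (rev H d)) \<or>
     h = b d \<and> k = w (rev H d) \<and> edge_of H d \<notin> A \<or> h = w d \<and> k = b d \<and> edge_of H d \<in> A)"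
proof -
  have "(h, k) \<in> seifert_adj D \<longleftrightarrow> h \<in> darts D \<and>
      (k = rev D h \<or> k = rot D h \<and> (h \<in> out D) \<noteq> (rot D h \<in> out D))"
    unfolding seifert_adj_def by blast
  also have "\<dots> \<longleftrightarrow> (\<exists>d\<in>darts H.
      h = b d \<and> (k = rev D (b d) \<or> k = rot D (b d) \<and> (b d \<in> out D) \<noteq> (rot D (b d) \<in> out D)) \<or>
      h = w d \<and> (k = rev D (w d) \<or> k = rot D (w d) \<and> (w d \<in> out D) \<noteq> (rot D (w d) \<in> out D)))"
    unfolding darts_D by blast
  also have "\<dots> \<longleftrightarrow> (\<exists>d\<in>darts H.
      h = b d \<and> (k = w (rev H (rot H d)) \<or> k = w (rev H d) \<and> edge_of H d \<notin> A) \<or>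
      h = w d \<and> (k = b (inv (rot H) (rev H d)) \<or> k = b d \<and> edge_of H d \<in> A))"
    by (rule bex_cong[OF refl]) (simp only: rev_b rev_w rot_b rot_w smoothing_b smoothing_w)
  finally show ?thesis by blast
qed

lemma quad_adj_iff:
  "(c, d) \<in> quad_adj H (edges (Phi H A)) \<longleftrightarrow>
     c \<in> darts H \<and> d = (if edge_of H c \<in> A then inv (rot H) (rev H c) else inv (rot H) c)"
  unfolding quad_adj_def H.edges_Phi[OF A] H.edges_graph_of by auto

abbreviation seifert_conn :: "('c \<times> 'c) set" where
  "seifert_conn \<equiv> (seifert_adj D \<union> (seifert_adj D)\<inverse>)\<^sup>*"

abbreviation quad_conn :: "('h \<times> 'h) set" where
  "quad_conn \<equiv> (quad_adj H (edges (Phi H A)) \<union> (quad_adj H (edges (Phi H A)))\<inverse>)\<^sup>*"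

lemma b_conn_w: "d \<in> darts H \<Longrightarrow> edge_of H d \<in> A \<Longrightarrow> (b d, w d) \<in> seifert_conn"
  by (rule r_into_rtrancl) (auto simp: seifert_adj_iff)

lemma b_conn_w_rev: "d \<in> darts H \<Longrightarrow> edge_of H d \<notin> A \<Longrightarrow> (b d, w (rev H d)) \<in> seifert_conn"
  by (rule r_into_rtrancl) (auto simp: seifert_adj_iff)

lemma w_conn_b_quad: "d \<in> darts H \<Longrightarrow> (w d, b (inv (rot H) (rev H d))) \<in> seifert_conn"
  by (rule r_into_rtrancl) (auto simp: seifert_adj_iff)

text \<open>The quadrangle that contains the diagram edge of the dart \<open>h\<close>.\<close>
definition quad :: "'c \<Rightarrow> 'h" where
  "quad h = (if h \<in> b ` darts H then inv_into (darts H) b h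
     else inv (rot H) (rev H (inv_into (darts H) w h)))"

lemma quad_b [simp]: "d \<in> darts H \<Longrightarrow> quad (b d) = d"
  by (simp add: quad_def inv_into_f_f[OF inj_b])

lemma quad_w [simp]: "d \<in> darts H \<Longrightarrow> quad (w d) = inv (rot H) (rev H d)"
  using b_neq_w by (auto simp: quad_def inv_into_f_f[OF inj_w])

lemma b_quad_conn:
  assumes "h \<in> darts D"
  shows "(b (quad h), h) \<in> seifert_conn"
proof -
  have "(b (inv (rot H) (rev H d)), w d) \<in> seifert_conn" if "d \<in> darts H" for d
    using that by (intro r_into_rtrancl) (auto simp: seifert_adj_iff)
  then show ?thesis using assms by (auto simp: darts_D)
qed

lemma quad_conn_if_seifert_conn:
  assumes "(h, k) \<in> seifert_conn"
  shows "(quad h, quad k) \<in> quad_conn"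
proof -
  have one_step: "(quad h, quad k) \<in> quad_conn \<and> (quad k, quad h) \<in> quad_conn"
    if "(h, k) \<in> seifert_adj D" for h k
  proof -
    have "quad h = quad k \<or> (quad h, quad k) \<in> quad_adj H (edges (Phi H A)) \<or>
        (quad k, quad h) \<in> quad_adj H (edges (Phi H A))"
      using that unfolding seifert_adj_iff by (auto simp: quad_adj_iff)
    then show ?thesis by auto
  qed
  show ?thesis using assms
  proof (induction rule: rtrancl_induct)
    case (step y z)
    then have "(y, z) \<in> seifert_adj D \<or> (z, y) \<in> seifert_adj D" by simp
    then have "(quad y, quad z) \<in> quad_conn" using one_step by metis
    with step.IH show ?case by (rule rtrancl_trans)
  qed simp
qed

lemma seifert_conn_if_quad_conn:
  assumes "(c, d) \<in> quad_conn"
  shows "(b c, b d) \<in> seifert_conn"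
proof -
  have sym: "sym seifert_conn" by (rule sym_rtrancl) (rule sym_Un_converse)
  have one_step: "(b c, b d) \<in> seifert_conn" if cd: "(c, d) \<in> quad_adj H (edges (Phi H A))" for c d
  proof -
    have c: "c \<in> darts H" using cd by (simp add: quad_adj_iff)
    consider "edge_of H c \<in> A" "d = inv (rot H) (rev H c)" | "edge_of H c \<notin> A" "d = inv (rot H) c"
      using cd by (auto simp: quad_adj_iff)
    then show ?thesis
    proof cases
      case 1
      have "(b c, w c) \<in> seifert_conn" "(w c, b d) \<in> seifert_conn"
        using c 1 b_conn_w w_conn_b_quad by simp_all
      then show ?thesis by (rule rtrancl_trans)
    next
      case 2
      have "(b c, w (rev H c)) \<in> seifert_conn" "(w (rev H c), b d) \<in> seifert_conn"
        using c 2 b_conn_w_rev w_conn_b_quad[of "rev H c"] by simp_all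
      then show ?thesis by (rule rtrancl_trans)
    qed
  qed
  show ?thesis using assms
  proof (induction rule: rtrancl_induct)
    case (step y z)
    then have "(y, z) \<in> quad_adj H (edges (Phi H A)) \<or> (z, y) \<in> quad_adj H (edges (Phi H A))" by simp
    then have "(b y, b z) \<in> seifert_conn" using one_step symD[OF sym one_step] by metis
    with step.IH show ?case by (rule rtrancl_trans)
  qed simp
qed

lemma seifert_circle_eq_iff: "seifert_circle D h = seifert_circle D k \<longleftrightarrow> (h, k) \<in> seifert_conn"
  unfolding seifert_circle_def by (rule sym_closure_Image_eq_iff)

lemma region_of_eq_iff:
  "region_of H (edges (Phi H A)) c = region_of H (edges (Phi H A)) d \<longleftrightarrow> (c, d) \<in> quad_conn"
  unfolding region_of_def by (rule sym_closure_Image_eq_iff)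

text \<open>
  A Seifert circle follows a boundary curve of a neighbourhood of \<open>\<Phi>\<close>: at each crossing it stays
  on one side of the edge of \<open>\<Phi>\<close>.  It therefore runs inside one region, and it visits exactly the
  quadrangles of that region.
\<close>
lemma seifert_circle_eq_iff_region_of_eq:
  assumes "c \<in> darts H" "d \<in> darts H"
  shows "seifert_circle D (b c) = seifert_circle D (b d) \<longleftrightarrow>
    region_of H (edges (Phi H A)) c = region_of H (edges (Phi H A)) d"
  unfolding seifert_circle_eq_iff region_of_eq_iff
  using quad_conn_if_seifert_conn[of "b c" "b d"] seifert_conn_if_quad_conn[of c d]
  unfolding quad_b[OF assms(1)] quad_b[OF assms(2)] by (rule iffI)

text \<open>
  The ends in \<^const>\<open>seifert_graph\<close> are read off at an arbitrary pair of opposite darts of the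
  crossing.  The pairs of \<open>b\<close>-darts and of \<open>w\<close>-darts give the same result, since each of the two
  arcs of the smoothing has one dart of either kind.
\<close>
lemma ends_seifert_graph:
  assumes d: "d \<in> darts H"
  shows "ends (seifert_graph D) (vertex_of D (b d)) =
    Upair (seifert_circle D (b d)) (seifert_circle D (b (rev H d)))"
proof -
  let ?s = "seifert_circle D"
  have same: "(?s (b d) = ?s (w d) \<and> ?s (b (rev H d)) = ?s (w (rev H d))) \<or>
      (?s (b d) = ?s (w (rev H d)) \<and> ?s (b (rev H d)) = ?s (w d))"
  proof (cases "edge_of H d \<in> A")
    case True
    then have "(b d, w d) \<in> seifert_conn" "(b (rev H d), w (rev H d)) \<in> seifert_conn"
      using d by (simp_all add: b_conn_w)
    then show ?thesis by (simp add: seifert_circle_eq_iff)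
  next
    case False
    then have "(b d, w (rev H d)) \<in> seifert_conn" "(b (rev H d), w d) \<in> seifert_conn"
      using d b_conn_w_rev[of d] b_conn_w_rev[of "rev H d"] by simp_all
    then show ?thesis by (simp add: seifert_circle_eq_iff)
  qed
  have opp: "opp D (b d) = b (rev H d)" "opp D (b (rev H d)) = b d"
      "opp D (w d) = w (rev H d)" "opp D (w (rev H d)) = w d"
    using d by (simp_all add: rot_b rot_w)
  show ?thesis
    unfolding seifert_graph_def using same
    by (auto simp: vertex_of_b[OF d] opp intro!: the_equality)
qed

theorem seifert_graph_isomorphic_circled_dual: "seifert_graph D \<cong>\<^sub>G circled_dual H (Phi H A)"
proof -
  let ?S = "seifert_graph D" and ?K = "circled_dual H (Phi H A)"
  let ?region = "region_of H (edges (Phi H A))"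
  let ?tag = "\<lambda>d. if edge_of H d \<in> A then Inl (edge_of H d) else Inr (edge_of H d)"
  obtain f0 where f0: "bij_betw f0 ((\<lambda>d. seifert_circle D (b d)) ` darts H) (?region ` darts H)"
      "\<And>d. d \<in> darts H \<Longrightarrow> f0 (seifert_circle D (b d)) = ?region d"
    using bij_betw_images[of "darts H" "\<lambda>d. seifert_circle D (b d)" ?region]
      seifert_circle_eq_iff_region_of_eq by blast
  have tag_eq: "vertex_of D (b c) = vertex_of D (b d) \<longleftrightarrow> ?tag c = ?tag d"
    if "c \<in> darts H" "d \<in> darts H" for c d
  proof -
    have "vertex_of D (b c) = vertex_of D (b d) \<longleftrightarrow> edge_of H c = edge_of H d"
      using that by (subst D.vertex_of_eq_iff) (simp add: vertex_of_b H.edge_of_eq_iff)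
    then show ?thesis by auto
  qed
  obtain g where g: "bij_betw g ((\<lambda>d. vertex_of D (b d)) ` darts H) (?tag ` darts H)"
      "\<And>d. d \<in> darts H \<Longrightarrow> g (vertex_of D (b d)) = ?tag d"
    using bij_betw_images[of "darts H" "\<lambda>d. vertex_of D (b d)" ?tag] tag_eq by blast
  have edges_S: "edges ?S = (\<lambda>d. vertex_of D (b d)) ` darts H"
    by (auto simp: seifert_graph_def crossings_def darts_D vertex_of_w)
  have edges_K: "edges ?K = ?tag ` darts H"
    using A by (auto simp: circled_dual_def H.edges_Phi[OF A] H.edges_graph_of)
  have "\<exists>f. bij_betw f (verts ?S) (verts ?K) \<and> (\<forall>d\<in>darts H. f (seifert_circle D (b d)) = ?region d)"
  proof (cases "darts H = {}")
    case True
    then have "verts ?S = {{}}" "verts ?K = {{}}"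
      using darts_D by (simp_all add: seifert_graph_def circled_dual_def cells_def)
    then show ?thesis using True by (auto intro: exI[of _ "\<lambda>_. {}"] simp: bij_betw_def)
  next
    case False
    have "seifert_circle D ` darts D = (\<lambda>d. seifert_circle D (b d)) ` darts H"
    proof
      show "seifert_circle D ` darts D \<subseteq> (\<lambda>d. seifert_circle D (b d)) ` darts H"
      proof (rule image_subsetI)
        fix h assume h: "h \<in> darts D"
        have "quad h \<in> darts H" using h by (auto simp: darts_D)
        then show "seifert_circle D h \<in> (\<lambda>d. seifert_circle D (b d)) ` darts H"
          using b_quad_conn[OF h] seifert_circle_eq_iff by blast
      qed
    qed (auto simp: darts_D)
    then have "verts ?S = (\<lambda>d. seifert_circle D (b d)) ` darts H" "verts ?K = ?region ` darts H"
      using False darts_D by (simp_all add: seifert_graph_def circled_dual_def cells_def)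
    then show ?thesis using f0 by auto
  qed
  then obtain f where f: "bij_betw f (verts ?S) (verts ?K)"
      "\<And>d. d \<in> darts H \<Longrightarrow> f (seifert_circle D (b d)) = ?region d" by blast
  have "ends ?K (g e) = map_uprod f (ends ?S e)" if e: "e \<in> edges ?S" for e
  proof -
    obtain d where d: "d \<in> darts H" "e = vertex_of D (b d)" using e edges_S by blast
    then show ?thesis
      using g(2) f(2) by (simp add: ends_seifert_graph circled_dual_def edge_of_def[of H d])
  qed
  then show ?thesis
    unfolding graph_isomorphic_def using f(1) g(1) edges_S edges_K by auto
qed

lemma graph_seifert_graph: "graph (seifert_graph D)"
  unfolding graph_def
proof
  fix e assume "e \<in> edges (seifert_graph D)"
  then obtain d where d: "d \<in> darts H" "e = vertex_of D (b d)"
    by (auto simp: seifert_graph_def crossings_def darts_D vertex_of_w)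
  then show "set_uprod (ends (seifert_graph D) e) \<subseteq> verts (seifert_graph D)"
    by (auto simp: ends_seifert_graph) (auto simp: seifert_graph_def cells_def darts_D)
qed

lemma Phi_eulerian: "\<forall>C\<in>components (Phi H A). eulerian C"
  using A out_rev in_A_iff by (rule H.Phi_eulerian_if_colouring)

end

section \<open>The Tait graph of a diagram\<close>

lemma permutes_orbit_card_4:
  assumes p: "p permutes S" "finite S" and card: "card (orbit p x) = 4"
  shows "p (p (p (p x))) = x" and "p (p x) \<noteq> x"
proof -
  have x: "x \<in> orbit p x" by (rule permutes_orbit_self[OF p])
  have "card (orbit p x) = funpow_dist1 p x x"
    using orbit_conv_funpow_dist1[OF x] card_image[OF inj_on_funpow_dist1[OF x]] by simp
  then have n: "funpow_dist1 p x x = 4" using card by simp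
  show "p (p (p (p x))) = x"
    using funpow_dist1_prop[OF x] unfolding n by (simp add: numeral_eq_Suc)
  show "p (p x) \<noteq> x"
    using funpow_dist1_least[of 2 p x x] unfolding n by (simp add: numeral_eq_Suc)
qed

lemma permutes_if_inj_on:
  assumes "finite S" "p ` S \<subseteq> S" "inj_on p S" "\<And>x. x \<notin> S \<Longrightarrow> p x = x"
  shows "p permutes S"
proof (rule bij_imp_permutes)
  show "bij_betw p S S" using assms(1-3) by (simp add: bij_betw_def endo_inj_surj)
qed (rule assms(4))

locale coloured_diagram = combinatorial_map D for D :: "'d link_diagram" +
  fixes B :: "'d set set"
  assumes diagram: "oriented_link_diagram D" and colouring: "checkerboard D B"
begin

lemma plane: "plane_graph D"
  using diagram by (simp add: oriented_link_diagram_def)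

lemma rot_over: "h \<in> darts D \<Longrightarrow> rot D h \<in> over D \<longleftrightarrow> h \<notin> over D"
  and opp_out: "h \<in> darts D \<Longrightarrow> opp D h \<in> out D \<longleftrightarrow> h \<notin> out D"
  and rev_out: "h \<in> darts D \<Longrightarrow> rev D h \<in> out D \<longleftrightarrow> h \<notin> out D"
  using diagram by (simp_all add: oriented_link_diagram_def)

lemma opp_opp: "h \<in> darts D \<Longrightarrow> opp D (opp D h) = h"
  and opp_neq: "h \<in> darts D \<Longrightarrow> opp D h \<noteq> h"
  using diagram permutes_orbit_card_4[OF rot_permutes finite_darts, of h]
  by (simp_all add: oriented_link_diagram_def vertex_of_def)

abbreviation black :: "'d \<Rightarrow> bool" where
  "black h \<equiv> face_of D h \<in> B"

lemma black_rev: "h \<in> darts D \<Longrightarrow> black (rev D h) \<longleftrightarrow> \<not> black h"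
  using colouring unfolding checkerboard_def by blast

lemma black_inv_rot: "h \<in> darts D \<Longrightarrow> black (inv (rot D) h) \<longleftrightarrow> \<not> black h"
  by (simp add: face_of_inv_rot black_rev)

lemma black_rot: "h \<in> darts D \<Longrightarrow> black (rot D h) \<longleftrightarrow> \<not> black h"
  using black_inv_rot[of "rot D h"] by simp

lemma black_corners_iff: "h \<in> black_corners D B \<longleftrightarrow> h \<in> darts D \<and> black h"
  by (simp add: black_corners_def)

lemma tait_simps:
  "darts (tait_graph D B) = black_corners D B"
  "h \<in> black_corners D B \<Longrightarrow> rev (tait_graph D B) h = opp D h"
  "h \<in> black_corners D B \<Longrightarrow> rot (tait_graph D B) h = inv (rot D) (rev D h)"
  by (simp_all add: tait_graph_def perm_restrict_simps)

lemma opp_black: "h \<in> black_corners D B \<Longrightarrow> opp D h \<in> black_corners D B"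
  by (simp add: black_corners_iff black_rot)

lemma combinatorial_map_tait: "combinatorial_map (tait_graph D B)"
proof
  show "finite (darts (tait_graph D B))" by (simp add: tait_simps black_corners_def)
  then have fin: "finite (black_corners D B)" by (simp add: tait_simps)
  have rv: "rev (tait_graph D B) = perm_restrict (opp D) (black_corners D B)"
    and rt: "rot (tait_graph D B) = perm_restrict (inv (rot D) \<circ> rev D) (black_corners D B)"
    by (simp_all add: tait_graph_def)
  show "rot (tait_graph D B) permutes darts (tait_graph D B)"
    unfolding tait_simps(1) rt
  proof (rule permutes_if_inj_on[OF fin])
    show "inj_on (perm_restrict (inv (rot D) \<circ> rev D) (black_corners D B)) (black_corners D B)"
    proof (rule inj_onI)
      fix h k assume "h \<in> black_corners D B" "k \<in> black_corners D B" and
        "perm_restrict (inv (rot D) \<circ> rev D) (black_corners D B) h =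
          perm_restrict (inv (rot D) \<circ> rev D) (black_corners D B) k"
      then have "inv (rot D) (rev D h) = inv (rot D) (rev D k)" by (simp add: perm_restrict_simps)
      then show "h = k" by (metis rot_inv_rot(1) rev_rev)
    qed
  qed (auto simp: perm_restrict_simps black_corners_iff)
  show "rev (tait_graph D B) permutes darts (tait_graph D B)"
    unfolding tait_simps(1) rv
    by (rule permutes_if_inj_on[OF fin])
      (auto simp: perm_restrict_simps opp_black intro!: inj_onI)
  show "rev (tait_graph D B) h \<noteq> h" if "h \<in> darts (tait_graph D B)" for h
    using that opp_neq[of h] by (simp add: tait_simps black_corners_iff)
  show "rev (tait_graph D B) (rev (tait_graph D B) h) = h" if "h \<in> darts (tait_graph D B)" for h
    using that opp_opp[of h] opp_black[of h] by (simp add: tait_simps black_corners_iff)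
qed

sublocale tait: combinatorial_map "tait_graph D B"
  by (rule combinatorial_map_tait)

text \<open>
  Exchanging the strands at a crossing changes both its Tait sign and its oriented sign, so whether
  these agree is determined by the orientation: they do if the smoothing that respects it merges
  the black corners.
\<close>
lemma equal_weight_iff:
  assumes h: "h \<in> black_corners D B"
  shows "edge_of (tait_graph D B) h \<in> equal_weight_edges D B \<longleftrightarrow> (h \<in> out D \<longleftrightarrow> rot D h \<in> out D)"
proof -
  have hD: "h \<in> darts D" "black h" using h by (simp_all add: black_corners_iff)
  let ?c = "crossing_of_edge D (edge_of (tait_graph D B) h)"
  have "vertex_of D h = {h, rot D h, opp D h, rot D (opp D h)}"
  proof -
    have "(rot D ^^ 4) h = h" using opp_opp[OF hD(1)] by (simp add: numeral_eq_Suc)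
    then have "vertex_of D h = {(rot D ^^ m) h | m. m < 4}"
      unfolding vertex_of_def by (rule orbit_altdef_bounded) simp
    also have "{m. m < 4} = {0, 1, 2, 3 :: nat}" by auto
    then have "{(rot D ^^ m) h | m. m < 4} = (\<lambda>m. (rot D ^^ m) h) ` {0, 1, 2, 3}"
      by (simp only: setcompr_eq_image)
    finally show ?thesis by (simp add: numeral_eq_Suc)
  qed
  then have c: "?c = {h, rot D h, opp D h, rot D (opp D h)}"
    by (auto simp: crossing_of_edge_def edge_of_def tait_simps h)
  have over: "rot D h \<in> over D \<longleftrightarrow> h \<notin> over D" "opp D h \<in> over D \<longleftrightarrow> h \<in> over D"
      "rot D (opp D h) \<in> over D \<longleftrightarrow> h \<notin> over D"
    using hD by (simp_all add: rot_over)
  have out: "opp D h \<in> out D \<longleftrightarrow> h \<notin> out D" "rot D (opp D h) \<in> out D \<longleftrightarrow> rot D h \<notin> out D"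
    using hD opp_out[of h] opp_out[of "rot D h"] by simp_all
  have col: "\<not> black (rot D h)" "black (opp D h)" "\<not> black (rot D (opp D h))"
    using hD by (simp_all add: black_rot)
  have "tait_sign D B ?c = Plus \<longleftrightarrow> h \<in> over D"
    using over col hD(2) by (auto simp: tait_sign_def c)
  moreover have "crossing_sign D ?c = Plus \<longleftrightarrow> (h \<in> over D \<longleftrightarrow> (h \<in> out D \<longleftrightarrow> rot D h \<in> out D))"
    using over out opp_opp[OF hD(1)]
    by (cases "h \<in> over D"; cases "h \<in> out D"; cases "rot D h \<in> out D")
      (simp_all add: crossing_sign_def c Int_insert_left)
  moreover have "edge_of (tait_graph D B) h \<in> edges (graph_of (tait_graph D B))"
    using h by (simp add: tait.edges_graph_of tait_simps)
  moreover have "s = Minus \<longleftrightarrow> s \<noteq> Plus" for s by (cases s) simp_all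
  ultimately show ?thesis
    unfolding equal_weight_edges_def tait_weight_def by auto
qed

lemma inv_rot_tait:
  assumes "h \<in> darts D" "black h"
  shows "inv (rot (tait_graph D B)) h = rev D (rot D h)"
proof -
  have "rot (tait_graph D B) (rev D (rot D h)) = h"
    using assms by (simp add: tait_simps black_corners_iff black_rot black_rev)
  then show ?thesis using tait.rot_inv_rot(2)[of "rev D (rot D h)"] by simp
qed

text \<open>
  A diagram is the medial graph of its Tait graph.  A dart of the Tait graph is the dart of the
  diagram with the same black corner on its left, so \<open>b\<close> is the identity.
\<close>
lemma seifert_medial_tait:
  "seifert_medial (tait_graph D B) D (\<lambda>h. h) (inv (rot D)) (equal_weight_edges D B)"
proof
  show "inj_on (inv (rot D)) (darts (tait_graph D B))"
    using permutes_inj_on[OF permutes_inv[OF rot_permutes]] .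
  show "(\<lambda>h. h) ` darts (tait_graph D B) \<inter> inv (rot D) ` darts (tait_graph D B) = {}"
    by (auto simp: tait_simps black_corners_iff black_inv_rot)
  show "darts D = (\<lambda>h. h) ` darts (tait_graph D B) \<union> inv (rot D) ` darts (tait_graph D B)"
  proof -
    have "h \<in> inv (rot D) ` darts (tait_graph D B)" if "h \<in> darts D" "\<not> black h" for h
      using that by (intro image_eqI[of _ _ "rot D h"]) (simp_all add: tait_simps black_corners_iff black_rot)
    then show ?thesis by (fastforce simp: tait_simps black_corners_iff)
  qed
  show "equal_weight_edges D B \<subseteq> edges (graph_of (tait_graph D B))"
    by (auto simp: equal_weight_edges_def)
  fix h assume "h \<in> darts (tait_graph D B)"
  then have hT: "h \<in> black_corners D B" and h: "h \<in> darts D" "black h"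
    by (simp_all add: tait_simps black_corners_iff)
  have rw: "inv (rot (tait_graph D B)) (rev (tait_graph D B) h) = rev D (inv (rot D) h)"
    using h opp_opp[OF h(1)] inv_rot_tait[of "opp D h"] rot_inv_rot(2)[of "rot D (opp D h)"]
    by (simp add: tait_simps hT black_rot)
  show "rot D h = inv (rot D) (rev (tait_graph D B) h)" by (simp add: tait_simps hT)
  show "rot D (inv (rot D) h) = h" by simp
  show "rev D (inv (rot D) h) = inv (rot (tait_graph D B)) (rev (tait_graph D B) h)"
    by (simp add: rw)
  show "inv (rot D) h \<in> out D \<longleftrightarrow> inv (rot (tait_graph D B)) (rev (tait_graph D B) h) \<notin> out D"
    using h by (simp add: rw rev_out)
  show "rev (tait_graph D B) h \<in> out D \<longleftrightarrow> h \<notin> out D"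
    using h by (simp add: tait_simps hT opp_out)
  show "edge_of (tait_graph D B) h \<in> equal_weight_edges D B \<longleftrightarrow>
      (h \<in> out D) \<noteq> (inv (rot (tait_graph D B)) h \<in> out D)"
    using h by (simp add: equal_weight_iff[OF hT] inv_rot_tait rev_out)
qed simp

end

lemma coloured_diagramI:
  "oriented_link_diagram D \<Longrightarrow> checkerboard D B \<Longrightarrow> coloured_diagram D B"
  by (simp add: coloured_diagram_def coloured_diagram_axioms_def oriented_link_diagram_def plane_graph_iff)

theorem seifert_graph_of_diagram:
  assumes "oriented_link_diagram D" "checkerboard D B"
  defines "H \<equiv> tait_graph D B" and "A \<equiv> equal_weight_edges D B"
  shows "plane_graph H" and "A \<subseteq> edges (graph_of H)"
    and "\<forall>C\<in>components (Phi H A). eulerian C" and "seifert_graph D \<cong>\<^sub>G circled_dual H (Phi H A)"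
proof -
  interpret c: coloured_diagram D B using assms(1,2) by (rule coloured_diagramI)
  interpret m: seifert_medial H D "\<lambda>h. h" "inv (rot D)" A
    unfolding H_def A_def by (rule c.seifert_medial_tait)
  show "plane_graph H" using m.plane_graph_medial_iff c.plane by simp
  show "A \<subseteq> edges (graph_of H)" by (rule m.A)
  show "\<forall>C\<in>components (Phi H A). eulerian C" by (rule m.Phi_eulerian)
  show "seifert_graph D \<cong>\<^sub>G circled_dual H (Phi H A)" by (rule m.seifert_graph_isomorphic_circled_dual)
qed

text \<open>All vertices of a diagram have degree four, so its set of all edges is even and bounds.\<close>
lemma exists_checkerboard:
  fixes D :: "'a link_diagram"
  assumes "oriented_link_diagram D"
  shows "\<exists>B. checkerboard D B"
proof -
  have plane: "plane_graph D" and four: "\<And>h. h \<in> darts D \<Longrightarrow> card (vertex_of D h) = 4"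
    using assms by (simp_all add: oriented_link_diagram_def)
  interpret combinatorial_map D using plane by (simp add: plane_graph_iff)
  have "even (card {c \<in> vertex_of D h. True})" if "h \<in> darts D" for h
    using four[OF that] by simp
  then obtain P :: "'a \<Rightarrow> bool" where
    P: "\<forall>h\<in>darts D. P (inv (rot D) (rev D h)) = P h" "\<forall>h\<in>darts D. True \<longleftrightarrow> P h \<noteq> P (rev D h)"
    using even_edge_set_bounds[OF plane, of "\<lambda>_. True"] by blast
  define B where "B = face_of D ` {h \<in> darts D. P h}"
  have const: "P k = P h" if "h \<in> darts D" "k \<in> face_of D h" for h k
  proof -
    have "k \<in> darts D \<and> P k = P h"
      using that(2) unfolding face_of_def vertex_of_def
      by induction (use that(1) P(1) in simp_all)
    then show ?thesis by blast
  qed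
  have black: "face_of D h \<in> B \<longleftrightarrow> P h" if "h \<in> darts D" for h
    using that const face_of_eq_iff unfolding B_def by blast
  have "B \<subseteq> faces D" by (auto simp: B_def faces_def cells_def)
  moreover have "face_of D h \<in> B \<longleftrightarrow> face_of D (rev D h) \<notin> B" if h: "h \<in> darts D" for h
    using black[OF h] black[of "rev D h"] P(2)[rule_format, OF h] h by simp
  ultimately show ?thesis unfolding checkerboard_def by (intro exI[of _ B] conjI ballI)
qed

section \<open>The diagram of a plane graph and a set of edges\<close>

text \<open>
  The medial graph, with the darts \<open>b d\<close> on over-strands and oriented by the colouring \<open>z\<close> of the
  quadrangles: the diagram edge inside a quadrangle runs counterclockwise around its corner at a
  vertex of \<open>H\<close>, leaving the crossing along \<open>b d\<close>, if and only if \<open>z\<close> holds.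
\<close>
definition medial_diagram ::
    "'h plane_map \<Rightarrow> ('h \<Rightarrow> 'c) \<Rightarrow> ('h \<Rightarrow> 'c) \<Rightarrow> ('h \<Rightarrow> bool) \<Rightarrow> 'c link_diagram" where
  "medial_diagram H b w z =
    (let b' = inv_into (darts H) b; w' = inv_into (darts H) w in
     \<lparr>darts = b ` darts H \<union> w ` darts H,
      rev = (\<lambda>h. if h \<in> b ` darts H then w (rev H (rot H (b' h)))
                 else if h \<in> w ` darts H then b (inv (rot H) (rev H (w' h))) else h),
      rot = (\<lambda>h. if h \<in> b ` darts H then w (rev H (b' h))
                 else if h \<in> w ` darts H then b (w' h) else h),
      over = b ` darts H,
      out = b ` {d \<in> darts H. z d} \<union> w ` {d \<in> darts H. \<not> z (inv (rot H) (rev H d))}\<rparr>)"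

lemma medial_medial_diagram:
  assumes "combinatorial_map H" and inj: "inj_on b (darts H)" "inj_on w (darts H)"
    and disj: "b ` darts H \<inter> w ` darts H = {}"
  shows "medial H (medial_diagram H b w z) b w"
proof -
  interpret H: combinatorial_map H by (rule assms(1))
  let ?D = "medial_diagram H b w z"
  have w_notin: "w d \<notin> b ` darts H" if "d \<in> darts H" for d using disj that by blast
  have darts: "darts ?D = b ` darts H \<union> w ` darts H" by (simp add: medial_diagram_def Let_def)
  have rot: "rot ?D (b d) = w (rev H d)" "rot ?D (w d) = b d"
    and rv: "rev ?D (b d) = w (rev H (rot H d))" "rev ?D (w d) = b (inv (rot H) (rev H d))"
    if "d \<in> darts H" for d
    using that w_notin inj by (simp_all add: medial_diagram_def Let_def)
  have outside: "rot ?D h = h" "rev ?D h = h" if "h \<notin> darts ?D" for h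
    using that by (simp_all add: darts) (simp_all add: medial_diagram_def Let_def)
  have eq_iff: "b c = b d \<longleftrightarrow> c = d" "w c = w d \<longleftrightarrow> c = d" "b c \<noteq> w d" "w d \<noteq> b c"
    if "c \<in> darts H" "d \<in> darts H" for c d
    using that inj disj by (auto dest: inj_onD)
  have cases: "P h" if "h \<in> darts ?D" "\<And>d. d \<in> darts H \<Longrightarrow> P (b d)" "\<And>d. d \<in> darts H \<Longrightarrow> P (w d)" for P h
    using that by (auto simp: darts)
  have in_D: "b d \<in> darts ?D" "w d \<in> darts ?D" if "d \<in> darts H" for d using that by (simp_all add: darts)
  have rot_rot: "rot ?D (rot ?D (rot ?D (rot ?D h))) = h" if "h \<in> darts ?D" for h
    by (rule cases[OF that]) (simp_all add: rot)
  have rev_rev: "rev ?D (rev ?D h) = h" if "h \<in> darts ?D" for h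
    by (rule cases[OF that]) (simp_all add: rv)
  show ?thesis
  proof
    show fin: "finite (darts ?D)" by (simp add: darts)
    show "rot ?D permutes darts ?D"
    proof (rule permutes_if_inj_on[OF fin])
      show "rot ?D ` darts ?D \<subseteq> darts ?D"
      proof (rule image_subsetI)
        fix h assume "h \<in> darts ?D"
        then show "rot ?D h \<in> darts ?D" by (rule cases) (simp_all add: rot in_D)
      qed
      show "inj_on (rot ?D) (darts ?D)" using rot_rot by (metis inj_onI)
    qed (rule outside)
    show "rev ?D permutes darts ?D"
    proof (rule permutes_if_inj_on[OF fin])
      show "rev ?D ` darts ?D \<subseteq> darts ?D"
      proof (rule image_subsetI)
        fix h assume "h \<in> darts ?D"
        then show "rev ?D h \<in> darts ?D" by (rule cases) (simp_all add: rv in_D)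
      qed
      show "inj_on (rev ?D) (darts ?D)" using rev_rev by (metis inj_onI)
    qed (rule outside)
    show "rev ?D h \<noteq> h" if "h \<in> darts ?D" for h
      by (rule cases[OF that]) (simp_all add: rv eq_iff)
  qed (use inj disj rev_rev in \<open>simp_all add: darts rot rv\<close>)
qed

theorem diagram_of_plane_graph:
  fixes H :: "'h plane_map" and b w :: "'h \<Rightarrow> 'c"
  assumes plane: "plane_graph H" and A: "A \<subseteq> edges (graph_of H)"
    and euler: "\<forall>C\<in>components (Phi H A). eulerian C"
    and inj: "inj_on b (darts H)" "inj_on w (darts H)" and disj: "b ` darts H \<inter> w ` darts H = {}"
  obtains D :: "'c link_diagram" and B f where "oriented_link_diagram D" "seifert_graph D \<cong>\<^sub>G circled_dual H (Phi H A)"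
    "graph (seifert_graph D)" "checkerboard D B" "plane_iso f (tait_graph D B) H"
    "map_uprod f ` equal_weight_edges D B = A"
proof -
  obtain z :: "'h \<Rightarrow> bool" where z_rev: "\<And>d. d \<in> darts H \<Longrightarrow> z (rev H d) \<longleftrightarrow> \<not> z d"
    and z_A: "\<And>d. d \<in> darts H \<Longrightarrow> edge_of H d \<in> A \<longleftrightarrow> z d \<noteq> z (inv (rot H) d)"
    using colouring_if_Phi_eulerian[OF plane A euler] by blast
  define D where "D = medial_diagram H b w z"
  have "combinatorial_map H" using plane by (simp add: plane_graph_iff)
  then interpret m: medial H D b w unfolding D_def using inj disj by (rule medial_medial_diagram)
  have over_D: "b d \<in> over D" "w d \<notin> over D" if "d \<in> darts H" for d
    using that disj by (auto simp: D_def medial_diagram_def Let_def)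
  have out_D: "b d \<in> out D \<longleftrightarrow> z d" "w d \<in> out D \<longleftrightarrow> \<not> z (inv (rot H) (rev H d))"
    if "d \<in> darts H" for d
    using that m.b_w_neq by (auto simp: D_def medial_diagram_def Let_def)
  have z_inv_rot: "z (inv (rot H) (rev H d)) \<longleftrightarrow> \<not> z (inv (rot H) d)" if "d \<in> darts H" for d
    using that z_A[of d] z_A[of "rev H d"] z_rev[of d] by auto
  interpret m: seifert_medial H D b w A
  proof
    fix d assume "d \<in> darts H"
    then show "w d \<in> out D \<longleftrightarrow> b (inv (rot H) (rev H d)) \<notin> out D" "b (rev H d) \<in> out D \<longleftrightarrow> b d \<notin> out D"
      "edge_of H d \<in> A \<longleftrightarrow> (b d \<in> out D) \<noteq> (b (inv (rot H) d) \<in> out D)"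
      by (simp_all add: out_D z_rev z_A)
  qed (rule A)
  have cases: "P h" if "h \<in> darts D" "\<And>d. d \<in> darts H \<Longrightarrow> P (b d)" "\<And>d. d \<in> darts H \<Longrightarrow> P (w d)" for P h
    using that by (auto simp: m.darts_D)
  have diagram: "oriented_link_diagram D"
    unfolding oriented_link_diagram_def
  proof (intro conjI ballI)
    show "plane_graph D" using plane by (simp add: m.plane_graph_medial_iff)
    show "over D \<subseteq> darts D" "out D \<subseteq> darts D"
      by (auto simp: m.darts_D) (auto simp: D_def medial_diagram_def Let_def)
    fix h assume h: "h \<in> darts D"
    show "card (vertex_of D h) = 4" by (rule m.card_vertex_of[OF h])
    show "rot D h \<in> over D \<longleftrightarrow> h \<notin> over D"
      by (rule cases[OF h]) (simp_all add: m.rot_b m.rot_w over_D)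
    show "opp D h \<in> out D \<longleftrightarrow> h \<notin> out D"
      by (rule cases[OF h]) (simp_all add: m.rot_b m.rot_w out_D z_rev z_inv_rot)
    show "rev D h \<in> out D \<longleftrightarrow> h \<notin> out D"
      by (rule cases[OF h]) (simp_all add: m.rev_b m.rev_w out_D)
  qed
  define B where "B = (\<lambda>d. face_of D (b d)) ` darts H"
  have black: "face_of D (b d) \<in> B" "face_of D (w d) \<notin> B" if d: "d \<in> darts H" for d
  proof -
    show "face_of D (b d) \<in> B" using d by (simp add: B_def)
    have "w d \<in> face_of D (w d)" by simp
    moreover have "w d \<notin> face_of D (b c)" if "c \<in> darts H" for c
      using that d m.H.vertex_of_subset[OF that] m.b_w_neq by (auto simp: m.face_of_b)
    ultimately show "face_of D (w d) \<notin> B" unfolding B_def by blast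
  qed
  have colouring: "checkerboard D B"
    unfolding checkerboard_def
  proof (intro conjI ballI)
    show "B \<subseteq> faces D" by (auto simp: B_def faces_def cells_def m.darts_D)
    fix h assume h: "h \<in> darts D"
    show "face_of D h \<in> B \<longleftrightarrow> face_of D (rev D h) \<notin> B"
      by (rule cases[OF h]) (simp_all add: m.rev_b m.rev_w black)
  qed
  interpret c: coloured_diagram D B using diagram colouring by (rule coloured_diagramI)
  have corners: "black_corners D B = b ` darts H"
    using black by (auto simp: black_corners_def m.darts_D)
  define f where "f = inv_into (darts H) b"
  have f_b: "f (b d) = d" if "d \<in> darts H" for d
    unfolding f_def using that by (rule inv_into_f_f[OF inj(1)])
  have rev_T: "rev (tait_graph D B) (b d) = b (rev H d)"
    and rot_T: "rot (tait_graph D B) (b d) = b (rot H d)" if "d \<in> darts H" for d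
    using that by (simp_all add: c.tait_simps corners m.rot_b m.rot_w m.rev_b m.inv_rot_w)
  have iso: "plane_iso f (tait_graph D B) H"
    unfolding plane_iso_def c.tait_simps(1) corners
    using bij_betw_inv_into[OF bij_betw_imageI[OF inj(1) refl]]
    by (auto simp: rev_T rot_T f_b) (simp add: f_def)
  have weights: "map_uprod f ` equal_weight_edges D B = A"
  proof -
    have edge: "map_uprod f (edge_of (tait_graph D B) (b d)) = edge_of H d" if "d \<in> darts H" for d
      using that by (simp add: edge_of_def rev_T f_b)
    have "edge_of (tait_graph D B) (b d) \<in> equal_weight_edges D B \<longleftrightarrow> edge_of H d \<in> A"
      if "d \<in> darts H" for d
      using that c.equal_weight_iff[of "b d"] m.smoothing_b[OF that] by (simp add: corners m.rot_b) blast
    moreover have "equal_weight_edges D B \<subseteq> (\<lambda>d. edge_of (tait_graph D B) (b d)) ` darts H"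
      by (auto simp: equal_weight_edges_def c.tait.edges_graph_of c.tait_simps corners)
    ultimately have "equal_weight_edges D B = (\<lambda>d. edge_of (tait_graph D B) (b d)) ` {d \<in> darts H. edge_of H d \<in> A}"
      by blast
    then have "map_uprod f ` equal_weight_edges D B = edge_of H ` {d \<in> darts H. edge_of H d \<in> A}"
      by (simp only: image_image) (rule image_cong[OF refl], simp add: edge)
    then show ?thesis using A by (auto simp: m.H.edges_graph_of)
  qed
  show ?thesis
    by (rule that[OF diagram m.seifert_graph_isomorphic_circled_dual m.graph_seifert_graph
          colouring iso weights])
qed

theorem theorem1:
  fixes G :: "('v, 'e) mgraph"
  assumes "graph G"
  shows
    "((\<exists>D :: nat link_diagram. oriented_link_diagram D \<and> G \<cong>\<^sub>G seifert_graph D) \<longleftrightarrow>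
      (\<exists>(H :: nat plane_map) A. plane_graph H \<and> A \<subseteq> edges (graph_of H) \<and>
         (\<forall>C\<in>components (Phi H A). eulerian C) \<and> G \<cong>\<^sub>G circled_dual H (Phi H A)))
     \<and>
     (\<forall>(D :: 'd link_diagram) B H A.
        oriented_link_diagram D \<and> G \<cong>\<^sub>G seifert_graph D \<and> checkerboard D B \<and>
        H = tait_graph D B \<and> A = equal_weight_edges D B \<longrightarrow>
        plane_graph H \<and> A \<subseteq> edges (graph_of H) \<and>
        (\<forall>C\<in>components (Phi H A). eulerian C) \<and> G \<cong>\<^sub>G circled_dual H (Phi H A))
     \<and>
     (\<forall>(H :: 'h plane_map) A.
        plane_graph H \<and> A \<subseteq> edges (graph_of H) \<and>
        (\<forall>C\<in>components (Phi H A). eulerian C) \<and> G \<cong>\<^sub>G circled_dual H (Phi H A) \<longrightarrow>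
        (\<exists>(D :: nat link_diagram) B f.
           oriented_link_diagram D \<and> G \<cong>\<^sub>G seifert_graph D \<and> checkerboard D B \<and>
           plane_iso f (tait_graph D B) H \<and> map_uprod f ` equal_weight_edges D B = A))"
proof -
  have forward: "plane_graph (tait_graph D B) \<and> equal_weight_edges D B \<subseteq> edges (graph_of (tait_graph D B)) \<and>
      (\<forall>C\<in>components (Phi (tait_graph D B) (equal_weight_edges D B)). eulerian C) \<and>
      G \<cong>\<^sub>G circled_dual (tait_graph D B) (Phi (tait_graph D B) (equal_weight_edges D B))"
    if "oriented_link_diagram D" "G \<cong>\<^sub>G seifert_graph D" "checkerboard D B"
    for D :: "'x link_diagram" and B
    using seifert_graph_of_diagram[OF that(1,3)] graph_isomorphic_trans[OF that(2)] by simp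
  have backward: "\<exists>(D :: nat link_diagram) B f.
      oriented_link_diagram D \<and> G \<cong>\<^sub>G seifert_graph D \<and> checkerboard D B \<and>
      plane_iso f (tait_graph D B) H \<and> map_uprod f ` equal_weight_edges D B = A"
    if H: "plane_graph H" "A \<subseteq> edges (graph_of H)" "\<forall>C\<in>components (Phi H A). eulerian C"
      and G: "G \<cong>\<^sub>G circled_dual H (Phi H A)"
    for H :: "'x plane_map" and A
  proof -
    have "finite (darts H)" using H(1) by (simp add: plane_graph_def)
    then obtain code :: "'x \<Rightarrow> nat" where code: "inj_on code (darts H)"
      using finite_imp_inj_to_nat_seg by blast
    \<comment> \<open>The two darts of the diagram at a corner of \<open>H\<close> become an even and an odd number.\<close>
    have "inj_on (\<lambda>d. 2 * code d) (darts H)" "inj_on (\<lambda>d. 2 * code d + 1) (darts H)"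
      using code by (auto simp: inj_on_def)
    moreover have "(\<lambda>d. 2 * code d) ` darts H \<inter> (\<lambda>d. 2 * code d + 1) ` darts H = {}"
      by auto presburger
    ultimately obtain D B f where D: "oriented_link_diagram (D :: nat link_diagram)"
      "seifert_graph D \<cong>\<^sub>G circled_dual H (Phi H A)" "graph (seifert_graph D)" "checkerboard D B"
      "plane_iso f (tait_graph D B) H" "map_uprod f ` equal_weight_edges D B = A"
      by (rule diagram_of_plane_graph[OF H])
    have "G \<cong>\<^sub>G seifert_graph D"
      by (rule graph_isomorphic_trans[OF G graph_isomorphic_sym[OF D(3,2)]])
    then show ?thesis using D by blast
  qed
  have abstract: "(\<exists>D :: nat link_diagram. oriented_link_diagram D \<and> G \<cong>\<^sub>G seifert_graph D) \<longleftrightarrow>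
      (\<exists>(H :: nat plane_map) A. plane_graph H \<and> A \<subseteq> edges (graph_of H) \<and>
         (\<forall>C\<in>components (Phi H A). eulerian C) \<and> G \<cong>\<^sub>G circled_dual H (Phi H A))"
  proof
    assume "\<exists>D :: nat link_diagram. oriented_link_diagram D \<and> G \<cong>\<^sub>G seifert_graph D"
    then obtain D :: "nat link_diagram" where D: "oriented_link_diagram D" "G \<cong>\<^sub>G seifert_graph D"
      by blast
    obtain B where "checkerboard D B" using exists_checkerboard[OF D(1)] by blast
    from forward[OF D this]
    show "\<exists>(H :: nat plane_map) A. plane_graph H \<and> A \<subseteq> edges (graph_of H) \<and>
        (\<forall>C\<in>components (Phi H A). eulerian C) \<and> G \<cong>\<^sub>G circled_dual H (Phi H A)"
      by (intro exI)
  next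
    assume "\<exists>(H :: nat plane_map) A. plane_graph H \<and> A \<subseteq> edges (graph_of H) \<and>
        (\<forall>C\<in>components (Phi H A). eulerian C) \<and> G \<cong>\<^sub>G circled_dual H (Phi H A)"
    then obtain H :: "nat plane_map" and A where "plane_graph H" "A \<subseteq> edges (graph_of H)"
      "\<forall>C\<in>components (Phi H A). eulerian C" "G \<cong>\<^sub>G circled_dual H (Phi H A)" by blast
    from backward[OF this]
    show "\<exists>D :: nat link_diagram. oriented_link_diagram D \<and> G \<cong>\<^sub>G seifert_graph D" by blast
  qed
  show ?thesis
  proof (rule conjI[OF abstract conjI]; intro allI impI; elim conjE)
    fix D :: "'d link_diagram" and B H A
    assume "oriented_link_diagram D" "G \<cong>\<^sub>G seifert_graph D" "checkerboard D B"
      and HA: "H = tait_graph D B" "A = equal_weight_edges D B"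
    then show "plane_graph H \<and> A \<subseteq> edges (graph_of H) \<and>
        (\<forall>C\<in>components (Phi H A). eulerian C) \<and> G \<cong>\<^sub>G circled_dual H (Phi H A)"
      unfolding HA by (intro forward)
  next
    fix H :: "'h plane_map" and A
    assume "plane_graph H" "A \<subseteq> edges (graph_of H)"
      "\<forall>C\<in>components (Phi H A). eulerian C" "G \<cong>\<^sub>G circled_dual H (Phi H A)"
    then show "\<exists>(D :: nat link_diagram) B f.
        oriented_link_diagram D \<and> G \<cong>\<^sub>G seifert_graph D \<and> checkerboard D B \<and>
        plane_iso f (tait_graph D B) H \<and> map_uprod f ` equal_weight_edges D B = A"
      by (rule backward)
  qed
qed

end
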